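(* Let a discrete group $\Gamma$ act on a compact Hausdorff space $X$. If the action is Lyapunov stable, then the conditional expectation $E_\Gamma : C(X)\to C_\Gamma(X)$ defined by $E_\Gamma(\varphi)(x)=M(\varphi_x)$ is well-defined, i.e. the following two conditions hold: 1') for any $\varphi\in C(X)$ the function $E_\Gamma(\varphi)(x):=M(\varphi_x)$ is continuous in $x$; 2') for any $x\in X$ and any non-zero $\varphi\in C(X)$ the map $\varphi_x$ is a non-zero almost periodic function on $\Gamma$.
   Context: Actions are continuous, i.e. $\Gamma$ acts on $X$ by homeomorphisms. $C(X)$ is the $C^*$-algebra of continuous complex-valued functions on $X$, and $C_\Gamma(X)\subset C(X)$ is the subalgebra of $\Gamma$-invariant functions. For $\varphi\in C(X)$ and $x\in X$, the function $\varphi_x:\Gamma\to\mathbb{C}$ is given by $\varphi_x(g)=\varphi(gx)$. The compact Hausdorff space $X$ carries its unique compatible uniform structure $\Phi$, consisting of all neighborhoods of the diagonal in $X\times X$. The action is Lyapunov stable if for every $\mathbb{U}\in\Phi$ and every $x\in X$ there is $\mathbb{V}\in\Phi$ such that, whenever $(x,y)\in\mathbb{V}$, one has $(gx,gy)\in\mathbb{U}$ for all $g\in\Gamma$. A bounded function $f:\Gamma\to\mathbb{C}$ is almost periodic if the set of its translates $\{h\mapsto f(hg) : g\in\Gamma\}$ is totally bounded in the uniform norm. $M$ denotes the unique invariant mean (positive, normalized, translation-invariant linear functional) on the space of almost periodic functions on $\Gamma$.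
   Formalization: In 2'), φ_x is claimed non-zero only when φ is non-zero somewhere on the closure of the orbit of x, since for arbitrary non-zero φ it fails (trivial group on two points); almost periodicity of φ_x is proved for all x and φ. *)

theory Defs
  imports "HOL-Analysis.Analysis" "HOL-Algebra.Group_Action"
begin

section \<open>Continuous actions and Lyapunov stability\<close>

text \<open>A discrete group is a group without further structure; only its carrier matters.\<close>

definition continuous_action ::
    "('g, 'c) monoid_scheme \<Rightarrow> 'a topology \<Rightarrow> ('g \<Rightarrow> 'a \<Rightarrow> 'a) \<Rightarrow> bool" where
  "continuous_action \<Gamma> X \<alpha> \<longleftrightarrow>
     group_action \<Gamma> (topspace X) \<alpha> \<and> (\<forall>g\<in>carrier \<Gamma>. homeomorphic_map X X (\<alpha> g))"

text \<open>For compact Hausdorff \<open>X\<close> these are the entourages of the unique compatible uniformity.\<close>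

definition diagonal_nbhds :: "'a topology \<Rightarrow> ('a \<times> 'a) set set" where
  "diagonal_nbhds X =
     {U. U \<subseteq> topspace X \<times> topspace X \<and>
         (\<exists>W. openin (prod_topology X X) W \<and> Id_on (topspace X) \<subseteq> W \<and> W \<subseteq> U)}"

definition lyapunov_stable ::
    "('g, 'c) monoid_scheme \<Rightarrow> 'a topology \<Rightarrow> ('g \<Rightarrow> 'a \<Rightarrow> 'a) \<Rightarrow> bool" where
  "lyapunov_stable \<Gamma> X \<alpha> \<longleftrightarrow>
     (\<forall>U\<in>diagonal_nbhds X. \<forall>x\<in>topspace X. \<exists>V\<in>diagonal_nbhds X.
        \<forall>y. (x, y) \<in> V \<longrightarrow> (\<forall>g\<in>carrier \<Gamma>. (\<alpha> g x, \<alpha> g y) \<in> U))"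


section \<open>The function algebras\<close>

text \<open>Values outside \<open>topspace X\<close> are unconstrained, so an element of \<open>C(X)\<close> is non-zero
  iff it is non-zero at a point of \<open>topspace X\<close>.\<close>

definition cont_funs :: "'a topology \<Rightarrow> ('a \<Rightarrow> complex) set" where
  "cont_funs X = {\<phi>. continuous_map X euclidean \<phi>}"

definition inv_cont_funs ::
    "('g, 'c) monoid_scheme \<Rightarrow> 'a topology \<Rightarrow> ('g \<Rightarrow> 'a \<Rightarrow> 'a) \<Rightarrow> ('a \<Rightarrow> complex) set" where
  "inv_cont_funs \<Gamma> X \<alpha> =
     {\<phi> \<in> cont_funs X. \<forall>g\<in>carrier \<Gamma>. \<forall>x\<in>topspace X. \<phi> (\<alpha> g x) = \<phi> x}"

definition orbit_fun ::
    "('g, 'c) monoid_scheme \<Rightarrow> ('g \<Rightarrow> 'a \<Rightarrow> 'a) \<Rightarrow> ('a \<Rightarrow> complex) \<Rightarrow> 'a \<Rightarrow> 'g \<Rightarrow> complex" where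
  "orbit_fun \<Gamma> \<alpha> \<phi> x = (\<lambda>g\<in>carrier \<Gamma>. \<phi> (\<alpha> g x))"


section \<open>Almost periodic functions and their invariant mean\<close>

text \<open>Functions on \<open>\<Gamma>\<close> are represented extensionally on the carrier.  \<open>Met_TC.fspace S\<close>
  is the space of bounded extensional functions on \<open>S\<close> and \<open>Met_TC.fdist S\<close> its sup metric.\<close>

definition translate ::
    "('g, 'c) monoid_scheme \<Rightarrow> 'g \<Rightarrow> ('g \<Rightarrow> complex) \<Rightarrow> 'g \<Rightarrow> complex" where
  "translate \<Gamma> g f = (\<lambda>h\<in>carrier \<Gamma>. f (h \<otimes>\<^bsub>\<Gamma>\<^esub> g))"

definition almost_periodic :: "('g, 'c) monoid_scheme \<Rightarrow> ('g \<Rightarrow> complex) set" where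
  "almost_periodic \<Gamma> =
     {f \<in> Met_TC.fspace (carrier \<Gamma>).
        Metric_space.mtotally_bounded (Met_TC.fspace (carrier \<Gamma>)) (Met_TC.fdist (carrier \<Gamma>))
          ((\<lambda>g. translate \<Gamma> g f) ` carrier \<Gamma>)}"

text \<open>Extensionality of \<open>M\<close> on the space of almost periodic functions encodes that this
  space is its domain; without it the mean would not be unique as a HOL function.\<close>

definition invariant_mean ::
    "('g, 'c) monoid_scheme \<Rightarrow> (('g \<Rightarrow> complex) \<Rightarrow> complex) \<Rightarrow> bool" where
  "invariant_mean \<Gamma> M \<longleftrightarrow>
     M \<in> extensional (almost_periodic \<Gamma>) \<and>
     (\<forall>f\<in>almost_periodic \<Gamma>. \<forall>f'\<in>almost_periodic \<Gamma>.
        M (\<lambda>h\<in>carrier \<Gamma>. f h + f' h) = M f + M f') \<and>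
     (\<forall>c. \<forall>f\<in>almost_periodic \<Gamma>. M (\<lambda>h\<in>carrier \<Gamma>. c * f h) = c * M f) \<and>
     (\<forall>f\<in>almost_periodic \<Gamma>. (\<forall>h\<in>carrier \<Gamma>. f h \<in> \<real>\<^sub>\<ge>\<^sub>0) \<longrightarrow> M f \<in> \<real>\<^sub>\<ge>\<^sub>0) \<and>
     M (\<lambda>h\<in>carrier \<Gamma>. 1) = 1 \<and>
     (\<forall>f\<in>almost_periodic \<Gamma>. \<forall>g\<in>carrier \<Gamma>. M (translate \<Gamma> g f) = M f)"

definition ap_mean :: "('g, 'c) monoid_scheme \<Rightarrow> ('g \<Rightarrow> complex) \<Rightarrow> complex" where
  "ap_mean \<Gamma> = (THE M. invariant_mean \<Gamma> M)"

definition expectation ::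
    "('g, 'c) monoid_scheme \<Rightarrow> ('g \<Rightarrow> 'a \<Rightarrow> 'a) \<Rightarrow> ('a \<Rightarrow> complex) \<Rightarrow> 'a \<Rightarrow> complex" where
  "expectation \<Gamma> \<alpha> \<phi> x = ap_mean \<Gamma> (orbit_fun \<Gamma> \<alpha> \<phi> x)"

end

theory Submission
  imports Defs
begin

text \<open>By Lyapunov stability and compactness the orbit maps \<open>x \<mapsto> \<phi>\<^sub>x\<close> are continuous for the
  uniform norm, and the translates of \<open>\<phi>\<^sub>x\<close> are again of the form \<open>\<phi>\<^bsub>gx\<^esub>\<close>; so they form a totally
  bounded set. What remains is that the invariant mean exists, is unique and is a contraction.
  Almost periodicity has a two-sided form, which provides a finite net that works for all
  averages of translates of \<open>f\<close> at once. An average with almost minimal supremum is then almost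
  constant. Both left and right averages of \<open>f\<close> therefore come close to constants, and since left
  and right averaging commute these constants agree in the limit. Their common value is the mean,
  and every right invariant mean must take this value.\<close>

section \<open>Averaging operators\<close>

text \<open>Since \<open>ap_mean\<close> is a definite description, it says nothing until exactly
  one invariant mean is known to exist; existence and uniqueness therefore precede any estimate of
  the expectation. The obstacle is noncommutativity. The mean is invariant under right translations,
  but two averages over right translations need not commute. Right averages alone thus give no
  direct proof that their limiting constant is unique, or that it is additive in the function. Left
  multiplications commute with right ones by associativity, so each side serves as the reference by
  which the other is tested. Noncommutativity also explains the two-sided net: averaging on the same
  side as a translation puts further factors beyond the translating element g, which ends up in the
  middle of a product h g k and has to be controlled uniformly in h and k.\<close>

definition trans_avg :: "('i \<Rightarrow> 's \<Rightarrow> 's) \<Rightarrow> 'i set \<Rightarrow> ('s \<Rightarrow> complex) \<Rightarrow> 's \<Rightarrow> complex" where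
  "trans_avg \<tau> N f x = (\<Sum>n\<in>N. f (\<tau> n x)) / of_nat (card N)"

text \<open>An average is kept as an operator rather than as a function, so that the same average
  can be applied to several functions, as linearity requires. The family \<open>\<tau>\<close> lets
  left and right translations share one development.\<close>

inductive_set averages :: "'i set \<Rightarrow> ('i \<Rightarrow> 's \<Rightarrow> 's) \<Rightarrow> (('s \<Rightarrow> complex) \<Rightarrow> 's \<Rightarrow> complex) set"
  for I \<tau> where
  id: "(\<lambda>f. f) \<in> averages I \<tau>"
| step: "T \<in> averages I \<tau> \<Longrightarrow> finite N \<Longrightarrow> N \<noteq> {} \<Longrightarrow> N \<subseteq> I
    \<Longrightarrow> (\<lambda>f. trans_avg \<tau> N (T f)) \<in> averages I \<tau>"

lemma trans_avg_convex:
  assumes "convex C" "finite N" "N \<noteq> {}" "\<And>n. n \<in> N \<Longrightarrow> f (\<tau> n x) \<in> C"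
  shows "trans_avg \<tau> N f x \<in> C"
proof -
  have "(\<Sum>n\<in>N. (1 / real (card N)) *\<^sub>R f (\<tau> n x)) \<in> C"
    using assms by (intro convex_sum) auto
  also have "(\<Sum>n\<in>N. (1 / real (card N)) *\<^sub>R f (\<tau> n x)) = trans_avg \<tau> N f x"
    by (simp add: trans_avg_def scaleR_conv_of_real sum_divide_distrib)
  finally show ?thesis .
qed

lemma trans_avg_diff:
  assumes "finite N" "N \<noteq> {}" "\<And>n. n \<in> N \<Longrightarrow> norm (f (\<tau> n x) - f (\<tau> n y)) \<le> \<epsilon>"
  shows "norm (trans_avg \<tau> N f x - trans_avg \<tau> N f y) \<le> \<epsilon>"
proof -
  have "norm (\<Sum>n\<in>N. f (\<tau> n x) - f (\<tau> n y)) \<le> real (card N) * \<epsilon>"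
    using assms(3) by (rule sum_norm_bound)
  moreover have "card N > 0"
    using assms by (simp add: card_gt_0_iff)
  ultimately show ?thesis
    by (simp add: trans_avg_def sum_subtractf norm_divide pos_divide_le_eq
        flip: diff_divide_distrib) (simp add: mult.commute)
qed

lemma averages_comp:
  assumes "T \<in> averages I \<tau>" "U \<in> averages I \<tau>"
  shows "(\<lambda>f. T (U f)) \<in> averages I \<tau>"
  using assms by (induction T rule: averages.induct) (auto intro: averages.intros)

text \<open>Every value of an average is a convex combination of values of \<open>f\<close>. Balls
  give norm estimates, half-planes control real parts, and closed convex sets later give positivity
  and normalization of the mean.\<close>

lemma averages_convex:
  assumes "T \<in> averages I \<tau>" and "\<And>i x. i \<in> I \<Longrightarrow> x \<in> S \<Longrightarrow> \<tau> i x \<in> S"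
    and "convex C" and "\<And>x. x \<in> S \<Longrightarrow> f x \<in> C" and "x \<in> S"
  shows "T f x \<in> C"
  using assms(1,5)
proof (induction arbitrary: x rule: averages.induct)
  case (step T N)
  then show ?case
    using assms(2,3) by (intro trans_avg_convex) blast+
qed (use assms in auto)

lemma averages_near:
  assumes "T \<in> averages I \<tau>" and "\<And>i x. i \<in> I \<Longrightarrow> x \<in> S \<Longrightarrow> \<tau> i x \<in> S"
    and "\<And>x. x \<in> S \<Longrightarrow> norm (f x - c) \<le> \<epsilon>" and "x \<in> S"
  shows "norm (T f x - c) \<le> \<epsilon>"
  using averages_convex[OF assms(1), of S "cball c \<epsilon>" f x] assms(2-)
  by (auto simp: dist_norm norm_minus_commute)

text \<open>Averages are local to \<open>S\<close>: this lets functions be changed freely outside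
  the carrier, where the group laws say nothing.\<close>

lemma averages_cong:
  assumes "T \<in> averages I \<tau>" and "\<And>i x. i \<in> I \<Longrightarrow> x \<in> S \<Longrightarrow> \<tau> i x \<in> S"
    and "\<And>x. x \<in> S \<Longrightarrow> f x = g x" and "x \<in> S"
  shows "T f x = T g x"
  using assms(1,4)
proof (induction arbitrary: x rule: averages.induct)
  case (step T N)
  then show ?case
    using assms(2) unfolding trans_avg_def
    by (intro arg_cong2[where f = "(/)"] sum.cong) auto
qed (use assms in auto)

lemma averages_linear:
  assumes "T \<in> averages I \<tau>"
  shows "T (\<lambda>x. a * f x + g x) = (\<lambda>x. a * T f x + T g x)"
  using assms
proof (induction rule: averages.induct)
  case (step T N)
  then show ?case
    by (simp add: trans_avg_def fun_eq_iff sum.distrib add_divide_distrib sum_distrib_left)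
qed auto

lemma averages_commute:
  assumes T: "T \<in> averages I \<tau>" and U: "U \<in> averages J \<sigma>"
    and \<tau>: "\<And>i x. i \<in> I \<Longrightarrow> x \<in> S \<Longrightarrow> \<tau> i x \<in> S"
    and \<sigma>: "\<And>j x. j \<in> J \<Longrightarrow> x \<in> S \<Longrightarrow> \<sigma> j x \<in> S"
    and comm: "\<And>i j x. i \<in> I \<Longrightarrow> j \<in> J \<Longrightarrow> x \<in> S \<Longrightarrow> \<tau> i (\<sigma> j x) = \<sigma> j (\<tau> i x)"
    and x: "x \<in> S"
  shows "T (U f) x = U (T f) x"
proof -
  \<comment> \<open>Moving one averaging step past the whole of \<open>U\<close>, by induction on
    \<open>U\<close>, is the only place where sums are interchanged; the induction on
    \<open>T\<close> then uses it once per step.\<close>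
  have single: "trans_avg \<tau> N (U f) x = U (trans_avg \<tau> N f) x"
    if "N \<subseteq> I" "x \<in> S" for N f x
    using U that(2)
  proof (induction arbitrary: x rule: averages.induct)
    case (step U M)
    have "trans_avg \<tau> N (trans_avg \<sigma> M (U f)) x = trans_avg \<sigma> M (trans_avg \<tau> N (U f)) x"
    proof -
      have "(\<Sum>n\<in>N. \<Sum>m\<in>M. U f (\<sigma> m (\<tau> n x))) = (\<Sum>n\<in>N. \<Sum>m\<in>M. U f (\<tau> n (\<sigma> m x)))"
        using step that(1) comm by (intro sum.cong refl) (metis subsetD)
      also have "\<dots> = (\<Sum>m\<in>M. \<Sum>n\<in>N. U f (\<tau> n (\<sigma> m x)))"
        by (rule sum.swap)
      finally show ?thesis
        by (simp add: trans_avg_def flip: sum_divide_distrib)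
    qed
    also have "\<dots> = trans_avg \<sigma> M (U (trans_avg \<tau> N f)) x"
      unfolding trans_avg_def[of \<sigma>] using step \<sigma>
      by (intro arg_cong2[where f = "(/)"] sum.cong) auto
    finally show ?case .
  qed auto
  show ?thesis
    using T x
  proof (induction arbitrary: x rule: averages.induct)
    case (step T N)
    have "trans_avg \<tau> N (T (U f)) x = trans_avg \<tau> N (U (T f)) x"
      unfolding trans_avg_def[of \<tau>] using step \<tau>
      by (intro arg_cong2[where f = "(/)"] sum.cong) auto
    then show ?case
      using single step by simp
  qed auto
qed

text \<open>An average \<open>u\<close> whose supremum is almost minimal is almost constant: averaging \<open>u\<close> over the
  net does not lower the supremum, so at some point all the averaged values of \<open>u\<close> are almost
  maximal, and by the net property these values represent all values of \<open>u\<close>.\<close>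

lemma small_oscillation:
  fixes \<F> :: "('s \<Rightarrow> real) set"
  assumes "u0 \<in> \<F>"
    and bound: "\<And>u x. u \<in> \<F> \<Longrightarrow> x \<in> S \<Longrightarrow> \<bar>u x\<bar> \<le> B"
    and closed: "\<And>i x. i \<in> I \<Longrightarrow> x \<in> S \<Longrightarrow> \<tau> i x \<in> S"
    and transitive: "\<And>x y. x \<in> S \<Longrightarrow> y \<in> S \<Longrightarrow> \<exists>i\<in>I. \<tau> i x = y"
    and avg: "\<And>u N. u \<in> \<F> \<Longrightarrow> finite N \<Longrightarrow> N \<noteq> {} \<Longrightarrow> N \<subseteq> I
        \<Longrightarrow> (\<lambda>x. (\<Sum>n\<in>N. u (\<tau> n x)) / real (card N)) \<in> \<F>"
    and N: "finite N" "N \<noteq> {}" "N \<subseteq> I"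
    and net: "\<And>i. i \<in> I \<Longrightarrow> \<exists>n\<in>N. \<forall>u\<in>\<F>. \<forall>x\<in>S. \<bar>u (\<tau> i x) - u (\<tau> n x)\<bar> \<le> \<epsilon>"
    and \<epsilon>: "\<epsilon> > 0"
  shows "\<exists>u\<in>\<F>. \<exists>c. \<forall>x\<in>S. \<bar>u x - c\<bar> \<le> 2 * \<epsilon>"
proof (cases "S = {}")
  case True
  then show ?thesis
    using assms(1) by auto
next
  case False
  \<comment> \<open>The minimal supremum in the family. It becomes the constant near which the
    selected \<open>u\<close> stays.\<close>
  define s where "s = (INF u\<in>\<F>. SUP x\<in>S. u x)"
  define k where "k = real (card N)"
  \<comment> \<open>Chosen so that \<open>2 * k * \<delta> = \<epsilon>\<close>: isolating one of
    \<open>k\<close> summands multiplies the deviation from \<open>s\<close> by about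
    \<open>2 * k\<close>.\<close>
  define \<delta> where "\<delta> = \<epsilon> / (2 * k)"
  have k: "k > 0"
    using N by (simp add: k_def card_gt_0_iff)
  have \<delta>: "\<delta> > 0"
    using k \<epsilon> by (simp add: \<delta>_def)
  have bdd: "bdd_above (u ` S)" if "u \<in> \<F>" for u
    using bound[OF that] by (intro bdd_aboveI[of _ B]) (auto dest: abs_le_D1)
  obtain z where "z \<in> S"
    using False by blast
  have "- B \<le> (SUP x\<in>S. u x)" if "u \<in> \<F>" for u
    using bound[OF that \<open>z \<in> S\<close>] cSUP_upper[OF \<open>z \<in> S\<close> bdd[OF that]] by linarith
  then have bddb: "bdd_below ((\<lambda>u. SUP x\<in>S. u x) ` \<F>)"
    by (intro bdd_belowI[of _ "-B"]) auto
  have "s < s + \<delta>"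
    using \<delta> by simp
  then obtain u where u: "u \<in> \<F>" "(SUP x\<in>S. u x) < s + \<delta>"
    unfolding s_def using cINF_less_iff[OF _ bddb] assms(1) by blast
  have u_less: "u x < s + \<delta>" if "x \<in> S" for x
    using cSUP_upper[OF that bdd[OF u(1)]] u(2) by linarith
  define v where "v x = (\<Sum>n\<in>N. u (\<tau> n x)) / real (card N)" for x
  have v: "v \<in> \<F>"
    unfolding v_def using avg[OF u(1) N] .
  have "s \<le> (SUP x\<in>S. v x)"
    unfolding s_def by (rule cINF_lower[OF bddb v])
  then have "s - \<delta> < (SUP x\<in>S. v x)"
    using \<delta> by linarith
  then obtain h where h: "h \<in> S" "s - \<delta> < v h"
    using less_cSUP_iff[OF False bdd[OF v]] by blast
  \<comment> \<open>The average at \<open>h\<close> exceeds \<open>s - \<delta>\<close> although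
    each of its \<open>k\<close> terms is below \<open>s + \<delta>\<close>. Hence no single term
    can be small: it is at least \<open>k * (s - \<delta>) - (k - 1) * (s + \<delta>)\<close>, which
    is \<open>s - \<epsilon> + \<delta>\<close>.\<close>
  have large: "u (\<tau> m h) > s - \<epsilon> + \<delta>" if "m \<in> N" for m
  proof -
    have "k * (s - \<delta>) < (\<Sum>n\<in>N. u (\<tau> n h))"
      using h(2) k by (simp add: v_def k_def[symmetric] pos_less_divide_eq mult.commute)
    also have "\<dots> = u (\<tau> m h) + (\<Sum>n\<in>N - {m}. u (\<tau> n h))"
      using N(1) that by (simp add: sum.remove)
    also have "(\<Sum>n\<in>N - {m}. u (\<tau> n h)) \<le> of_nat (card (N - {m})) * (s + \<delta>)"
      using N(3) closed h(1) u_less by (intro sum_bounded_above) (meson DiffD1 less_imp_le subsetD)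
    also have "of_nat (card (N - {m})) = k - 1"
      using N(1) that k by (simp add: k_def of_nat_diff card_gt_0_iff Suc_leI)
    finally have "u (\<tau> m h) > s - 2 * k * \<delta> + \<delta>"
      by (simp add: algebra_simps)
    moreover have "2 * k * \<delta> = \<epsilon>"
      using k by (simp add: \<delta>_def)
    ultimately show ?thesis
      by simp
  qed
  \<comment> \<open>By transitivity \<open>x\<close> is a translate of the special point
    \<open>h\<close>, and the net replaces that translate by one from \<open>N\<close>. The lower
    bound loses \<open>\<epsilon>\<close> in \<open>large\<close> and \<open>\<epsilon>\<close> in
    the net.\<close>
  have "\<bar>u x - s\<bar> \<le> 2 * \<epsilon>" if x: "x \<in> S" for x
  proof -
    obtain i where i: "i \<in> I" "\<tau> i h = x"
      using transitive h(1) x by blast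
    then obtain n where "n \<in> N" "\<bar>u x - u (\<tau> n h)\<bar> \<le> \<epsilon>"
      using net u(1) h(1) by metis
    moreover have "\<delta> \<le> \<epsilon>"
    proof -
      have "k \<ge> 1" using k by (simp add: k_def)
      then show ?thesis using \<epsilon> by (simp add: \<delta>_def divide_le_eq)
    qed
    ultimately show ?thesis
      using large[of n] u_less[OF x] \<delta> by linarith
  qed
  then show ?thesis
    using u(1) by blast
qed

text \<open>Minimizing a supremum needs real values, so the real part is flattened by
  \<open>T1\<close> and afterwards the imaginary part by \<open>T2\<close>. The second average
  cannot spoil the first gain, because a vertical strip is convex. The claim \<open>key\<close>
  concerns \<open>T1 f\<close> with \<open>T1\<close> arbitrary so that it serves both
  rounds.\<close>

lemma averages_almost_constant:
  fixes f :: "'s \<Rightarrow> complex"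
  assumes closed: "\<And>i x. i \<in> I \<Longrightarrow> x \<in> S \<Longrightarrow> \<tau> i x \<in> S"
    and transitive: "\<And>x y. x \<in> S \<Longrightarrow> y \<in> S \<Longrightarrow> \<exists>i\<in>I. \<tau> i x = y"
    and bound: "\<And>x. x \<in> S \<Longrightarrow> norm (f x) \<le> B"
    and net: "\<And>\<epsilon>. \<epsilon> > 0 \<Longrightarrow> \<exists>N. finite N \<and> N \<noteq> {} \<and> N \<subseteq> I \<and>
        (\<forall>i\<in>I. \<exists>n\<in>N. \<forall>T\<in>averages I \<tau>. \<forall>x\<in>S. norm (T f (\<tau> i x) - T f (\<tau> n x)) \<le> \<epsilon>)"
    and \<epsilon>: "\<epsilon> > 0"
  shows "\<exists>T\<in>averages I \<tau>. \<exists>c. \<forall>x\<in>S. norm (T f x - c) \<le> \<epsilon>"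
proof -
  have key: "\<exists>T\<in>averages I \<tau>. \<exists>c. \<forall>x\<in>S. \<bar>p (T (T1 f) x) - c\<bar> \<le> \<epsilon> / 2"
    if T1: "T1 \<in> averages I \<tau>" and p: "p = Re \<or> p = Im" for T1 and p :: "complex \<Rightarrow> real"
  proof -
    \<comment> \<open>\<open>small_oscillation\<close> doubles \<open>\<epsilon> / 4\<close>, and
      the bounds \<open>\<epsilon> / 2\<close> for the real and the imaginary part add up to
      \<open>\<epsilon>\<close>.\<close>
    obtain N where N: "finite N" "N \<noteq> {}" "N \<subseteq> I"
      "\<And>i. i \<in> I \<Longrightarrow> \<exists>n\<in>N. \<forall>T\<in>averages I \<tau>. \<forall>x\<in>S. norm (T f (\<tau> i x) - T f (\<tau> n x)) \<le> \<epsilon> / 4"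
      using net[of "\<epsilon> / 4"] \<epsilon> by auto
    have p_le: "\<bar>p z\<bar> \<le> norm z" for z
      using p abs_Re_le_cmod abs_Im_le_cmod by auto
    have p_diff: "p (z - w) = p z - p w" for z w
      using p by auto
    have p_avg: "p (trans_avg \<tau> M g x) = (\<Sum>n\<in>M. p (g (\<tau> n x))) / real (card M)" for M g x
      using p by (auto simp: trans_avg_def)
    have "\<exists>u\<in>{\<lambda>x. p (T (T1 f) x) |T. T \<in> averages I \<tau>}. \<exists>c. \<forall>x\<in>S. \<bar>u x - c\<bar> \<le> 2 * (\<epsilon> / 4)"
    proof (rule small_oscillation[OF _ _ closed transitive _ N(1-3)])
      show "(\<lambda>x. p (T1 f x)) \<in> {\<lambda>x. p (T (T1 f) x) |T. T \<in> averages I \<tau>}"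
        using averages.id[of I \<tau>] by auto
      show "\<bar>u x\<bar> \<le> B" if "u \<in> {\<lambda>x. p (T (T1 f) x) |T. T \<in> averages I \<tau>}" "x \<in> S" for u x
      proof -
        obtain T where T: "T \<in> averages I \<tau>" "u = (\<lambda>x. p (T (T1 f) x))"
          using \<open>u \<in> _\<close> by auto
        have "norm (T (T1 f) x - 0) \<le> B"
          using averages_comp[OF T(1) T1] closed bound that(2)
          by (intro averages_near[of "\<lambda>f. T (T1 f)" I \<tau> S]) auto
        then show ?thesis
          using p_le[of "T (T1 f) x"] T(2) by simp
      qed
      show "(\<lambda>x. (\<Sum>n\<in>M. u (\<tau> n x)) / real (card M)) \<in> {\<lambda>x. p (T (T1 f) x) |T. T \<in> averages I \<tau>}"
        if "u \<in> {\<lambda>x. p (T (T1 f) x) |T. T \<in> averages I \<tau>}" "finite M" "M \<noteq> {}" "M \<subseteq> I" for u M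
      proof -
        obtain T where T: "T \<in> averages I \<tau>" "u = (\<lambda>x. p (T (T1 f) x))"
          using \<open>u \<in> _\<close> by auto
        have "(\<lambda>x. (\<Sum>n\<in>M. u (\<tau> n x)) / real (card M)) = (\<lambda>x. p (trans_avg \<tau> M (T (T1 f)) x))"
          by (simp add: T(2) p_avg)
        then show ?thesis
          using averages.step[OF T(1) that(2-4)]
          by (auto intro!: exI[of _ "\<lambda>f. trans_avg \<tau> M (T f)"])
      qed
      show "\<exists>n\<in>N. \<forall>u\<in>{\<lambda>x. p (T (T1 f) x) |T. T \<in> averages I \<tau>}. \<forall>x\<in>S. \<bar>u (\<tau> i x) - u (\<tau> n x)\<bar> \<le> \<epsilon> / 4"
        if i: "i \<in> I" for i
      proof -
        obtain n where n: "n \<in> N"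
          "\<And>T x. T \<in> averages I \<tau> \<Longrightarrow> x \<in> S \<Longrightarrow> norm (T f (\<tau> i x) - T f (\<tau> n x)) \<le> \<epsilon> / 4"
          using N(4)[OF i] by blast
        have "\<bar>p (T (T1 f) (\<tau> i x)) - p (T (T1 f) (\<tau> n x))\<bar> \<le> \<epsilon> / 4"
          if "T \<in> averages I \<tau>" "x \<in> S" for T x
          using n(2)[OF averages_comp[OF that(1) T1] that(2)] p_le[of "T (T1 f) (\<tau> i x) - T (T1 f) (\<tau> n x)"]
          by (simp add: p_diff)
        then show ?thesis
          using n(1) by blast
      qed
    qed (use \<epsilon> in auto)
    then show ?thesis
      by auto
  qed
  obtain T1 a where T1: "T1 \<in> averages I \<tau>" and a: "\<And>x. x \<in> S \<Longrightarrow> \<bar>Re (T1 f x) - a\<bar> \<le> \<epsilon> / 2"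
    using key[OF averages.id, of Re] by auto
  obtain T2 b where T2: "T2 \<in> averages I \<tau>"
    and b: "\<And>x. x \<in> S \<Longrightarrow> \<bar>Im (T2 (T1 f) x) - b\<bar> \<le> \<epsilon> / 2"
    using key[OF T1, of Im] by auto
  have "norm (T2 (T1 f) x - Complex a b) \<le> \<epsilon>" if x: "x \<in> S" for x
  proof -
    \<comment> \<open>The strip around \<open>a\<close> is written as an intersection of two
      half-planes, whose convexity is known.\<close>
    have "T2 (T1 f) x \<in> {z. Re z \<le> a + \<epsilon> / 2} \<inter> {z. Re z \<ge> a - \<epsilon> / 2}"
    proof (rule averages_convex[OF T2 closed])
      show "convex ({z. Re z \<le> a + \<epsilon> / 2} \<inter> {z. Re z \<ge> a - \<epsilon> / 2})"
        by (intro convex_Int convex_halfspace_Re_le convex_halfspace_Re_ge)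
      show "T1 f y \<in> {z. Re z \<le> a + \<epsilon> / 2} \<inter> {z. Re z \<ge> a - \<epsilon> / 2}" if "y \<in> S" for y
        using a[OF that] by (simp; linarith)
    qed (use x in auto)
    then have "Re (T2 (T1 f) x) \<le> a + \<epsilon> / 2" "a - \<epsilon> / 2 \<le> Re (T2 (T1 f) x)"
      by simp_all
    then have "\<bar>Re (T2 (T1 f) x) - a\<bar> \<le> \<epsilon> / 2"
      by linarith
    then show ?thesis
      using b[OF x] cmod_le[of "T2 (T1 f) x - Complex a b"] by simp
  qed
  then show ?thesis
    by (intro bexI[OF _ averages_comp[OF T2 T1]] exI[of _ "Complex a b"]) simp
qed

section \<open>Almost periodic functions\<close>

definition near_translates ::
    "('g, 'c) monoid_scheme \<Rightarrow> ('g \<Rightarrow> complex) \<Rightarrow> real \<Rightarrow> 'g \<Rightarrow> 'g \<Rightarrow> bool" where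
  "near_translates G f \<epsilon> g g' \<longleftrightarrow>
     (\<forall>h\<in>carrier G. \<forall>k\<in>carrier G.
        norm (f (h \<otimes>\<^bsub>G\<^esub> g \<otimes>\<^bsub>G\<^esub> k) - f (h \<otimes>\<^bsub>G\<^esub> g' \<otimes>\<^bsub>G\<^esub> k)) \<le> \<epsilon>)"

text \<open>Maak's two-sided form of almost periodicity, symmetric in left and right translations;
  values outside the carrier are irrelevant.\<close>

definition bohr :: "('g, 'c) monoid_scheme \<Rightarrow> ('g \<Rightarrow> complex) \<Rightarrow> bool" where
  "bohr G f \<longleftrightarrow> bounded (f ` carrier G) \<and>
     (\<forall>\<epsilon>>0. \<exists>N\<subseteq>carrier G. finite N \<and> (\<forall>g\<in>carrier G. \<exists>n\<in>N. near_translates G f \<epsilon> g n))"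

text \<open>A colouring with finitely many colours yields a finite net inside \<open>A\<close>
  itself, even if the colours are not elements of \<open>A\<close> or record several approximations
  at once. The price is a factor 2, since elements of one colour are compared through their common
  colour.\<close>

lemma finite_representatives:
  assumes "finite (c ` A)"
  shows "\<exists>N\<subseteq>A. finite N \<and> (\<forall>a\<in>A. \<exists>n\<in>N. c a = c n)"
proof -
  obtain N where "N \<subseteq> A" "finite N" "c ` A = c ` N"
    using finite_subset_image[OF assms subset_refl] by auto
  moreover have "\<exists>n\<in>N. c a = c n" if "a \<in> A" for a
  proof -
    have "c a \<in> c ` N"
      using that \<open>c ` A = c ` N\<close> by blast
    then show ?thesis
      by auto
  qed
  ultimately show ?thesis
    by blast
qed

lemma bohr_net:
  assumes "bohr G f" "\<epsilon> > 0"
  obtains N where "N \<subseteq> carrier G" "finite N"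
    "\<And>g. g \<in> carrier G \<Longrightarrow> \<exists>n\<in>N. near_translates G f \<epsilon> g n"
proof -
  have "\<exists>N\<subseteq>carrier G. finite N \<and> (\<forall>g\<in>carrier G. \<exists>n\<in>N. near_translates G f \<epsilon> g n)"
    using assms by (simp add: bohr_def)
  then show thesis
    using that by auto
qed

lemma bohr_bound:
  assumes "bohr G f"
  obtains B where "\<And>g. g \<in> carrier G \<Longrightarrow> norm (f g) \<le> B"
proof -
  have "\<exists>B. \<forall>g\<in>carrier G. norm (f g) \<le> B"
    using assms by (simp add: bohr_def bounded_iff)
  then show thesis
    using that by auto
qed

lemma norm_diff_le_via:
  fixes x y w :: "'a :: real_normed_vector"
  assumes "norm (x - w) \<le> \<epsilon>" "norm (y - w) \<le> \<epsilon>"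
  shows "norm (x - y) \<le> 2 * \<epsilon>"
  using norm_triangle_ineq4[of "x - w" "y - w"] assms by simp

lemma (in monoid) bohr_cong:
  assumes "bohr G f" and "\<And>g. g \<in> carrier G \<Longrightarrow> f g = f' g"
  shows "bohr G f'"
proof -
  have "f ` carrier G = f' ` carrier G"
    using assms(2) by auto
  then have "bounded (f' ` carrier G)"
    using assms(1) by (simp add: bohr_def)
  moreover have "\<exists>N\<subseteq>carrier G. finite N \<and> (\<forall>g\<in>carrier G. \<exists>n\<in>N. near_translates G f' \<epsilon> g n)"
    if "\<epsilon> > 0" for \<epsilon>
  proof -
    have near: "near_translates G f' \<epsilon> g n"
      if "near_translates G f \<epsilon> g n" "g \<in> carrier G" "n \<in> carrier G" for g n
      using that assms(2) by (simp add: near_translates_def)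
    obtain N where "N \<subseteq> carrier G" "finite N" "\<And>g. g \<in> carrier G \<Longrightarrow> \<exists>n\<in>N. near_translates G f \<epsilon> g n"
      using bohr_net[OF assms(1) \<open>\<epsilon> > 0\<close>] by auto
    then show ?thesis
      using near by (intro exI[of _ N]) blast
  qed
  ultimately show ?thesis
    unfolding bohr_def by blast
qed

text \<open>A Lipschitz map turns simultaneous nets for \<open>f\<close> and \<open>f'\<close> into
  a net for the combination. Linear combinations and real and imaginary parts are all
  instances.\<close>

lemma (in monoid) bohr_lipschitz:
  fixes F :: "complex \<Rightarrow> complex \<Rightarrow> complex"
  assumes f: "bohr G f" and f': "bohr G f'"
    and F: "\<And>a b a' b'. norm (F a b - F a' b') \<le> L * (norm (a - a') + norm (b - b'))"
  shows "bohr G (\<lambda>g. F (f g) (f' g))"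
  unfolding bohr_def
proof (intro conjI allI impI)
  have "norm (F 1 0 - F 0 0) \<le> L"
    using F[of 1 0 0 0] by simp
  then have L: "L \<ge> 0"
    using norm_ge_zero order_trans by blast
  obtain B B' where B: "\<And>g. g \<in> carrier G \<Longrightarrow> norm (f g) \<le> B"
    and B': "\<And>g. g \<in> carrier G \<Longrightarrow> norm (f' g) \<le> B'"
    using f f' by (metis bohr_bound)
  have "norm (F (f g) (f' g)) \<le> norm (F 0 0) + L * (B + B')" if "g \<in> carrier G" for g
  proof -
    have "norm (F (f g) (f' g)) \<le> norm (F 0 0) + norm (F (f g) (f' g) - F 0 0)"
      by (metis add.commute diff_add_cancel norm_triangle_ineq)
    also have "norm (F (f g) (f' g) - F 0 0) \<le> L * (norm (f g) + norm (f' g))"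
      using F[of "f g" "f' g" 0 0] by simp
    also have "\<dots> \<le> L * (B + B')"
      using B B' that L by (intro mult_left_mono add_mono) auto
    finally show ?thesis by simp
  qed
  then show "bounded ((\<lambda>g. F (f g) (f' g)) ` carrier G)"
    unfolding bounded_iff by blast
next
  fix \<epsilon> :: real
  assume "\<epsilon> > 0"
  have "norm (F 1 0 - F 0 0) \<le> L"
    using F[of 1 0 0 0] by simp
  then have L: "L \<ge> 0"
    using norm_ge_zero order_trans by blast
  \<comment> \<open>Each of the two functions contributes \<open>2 * \<delta>\<close>, so
    \<open>4 * L * \<delta>\<close> must be at most \<open>\<epsilon>\<close>; the summand 1 keeps
    the denominator positive when \<open>L = 0\<close>.\<close>
  define \<delta> where "\<delta> = \<epsilon> / (4 * L + 1)"
  have \<delta>: "\<delta> > 0"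
    using \<open>\<epsilon> > 0\<close> L by (simp add: \<delta>_def)
  have "(4 * L + 1) * \<delta> = \<epsilon>"
    using L by (simp add: \<delta>_def)
  then have le: "L * (2 * \<delta> + 2 * \<delta>) \<le> \<epsilon>"
    using \<delta> by (simp add: algebra_simps)
  obtain N where N: "finite N" "\<And>g. g \<in> carrier G \<Longrightarrow> \<exists>n\<in>N. near_translates G f \<delta> g n"
    using bohr_net[OF f \<delta>] by metis
  obtain N' where N': "finite N'" "\<And>g. g \<in> carrier G \<Longrightarrow> \<exists>n\<in>N'. near_translates G f' \<delta> g n"
    using bohr_net[OF f' \<delta>] by metis
  obtain r where r: "\<And>g. g \<in> carrier G \<Longrightarrow> r g \<in> N \<and> near_translates G f \<delta> g (r g)"
    using N(2) by metis
  obtain r' where r': "\<And>g. g \<in> carrier G \<Longrightarrow> r' g \<in> N' \<and> near_translates G f' \<delta> g (r' g)"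
    using N'(2) by metis
  \<comment> \<open>Colouring by the pair of representatives is the common refinement of the two
    nets.\<close>
  have fin: "finite ((\<lambda>g. (r g, r' g)) ` carrier G)"
    by (rule finite_subset[of _ "N \<times> N'"]) (use N(1) N'(1) r r' in auto)
  obtain M where M: "M \<subseteq> carrier G" "finite M"
    "\<And>g. g \<in> carrier G \<Longrightarrow> \<exists>n\<in>M. (r g, r' g) = (r n, r' n)"
    using finite_representatives[OF fin] by auto
  have "\<exists>n\<in>M. near_translates G (\<lambda>g. F (f g) (f' g)) \<epsilon> g n" if g: "g \<in> carrier G" for g
  proof -
    obtain n where n: "n \<in> M" "r g = r n" "r' g = r' n"
      using M(3)[OF g] by auto
    then have nG: "n \<in> carrier G"
      using M(1) by auto
    have "norm (F (f (h \<otimes> g \<otimes> k)) (f' (h \<otimes> g \<otimes> k)) - F (f (h \<otimes> n \<otimes> k)) (f' (h \<otimes> n \<otimes> k))) \<le> \<epsilon>"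
      if "h \<in> carrier G" "k \<in> carrier G" for h k
    proof -
      have "norm (f (h \<otimes> g \<otimes> k) - f (h \<otimes> n \<otimes> k)) \<le> 2 * \<delta>"
        by (rule norm_diff_le_via[where w = "f (h \<otimes> r g \<otimes> k)"])
          (use r[OF g] r[OF nG] that in \<open>simp_all add: near_translates_def n(2)\<close>)
      moreover have "norm (f' (h \<otimes> g \<otimes> k) - f' (h \<otimes> n \<otimes> k)) \<le> 2 * \<delta>"
        by (rule norm_diff_le_via[where w = "f' (h \<otimes> r' g \<otimes> k)"])
          (use r'[OF g] r'[OF nG] that in \<open>simp_all add: near_translates_def n(3)\<close>)
      ultimately have "L * (norm (f (h \<otimes> g \<otimes> k) - f (h \<otimes> n \<otimes> k)) + norm (f' (h \<otimes> g \<otimes> k) - f' (h \<otimes> n \<otimes> k)))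
          \<le> L * (2 * \<delta> + 2 * \<delta>)"
        using L by (intro mult_left_mono add_mono)
      then show ?thesis
        by (rule order_trans[OF F order_trans[OF _ le]])
    qed
    then show ?thesis
      using n(1) by (auto simp: near_translates_def)
  qed
  then show "\<exists>N\<subseteq>carrier G. finite N \<and>
      (\<forall>g\<in>carrier G. \<exists>n\<in>N. near_translates G (\<lambda>g. F (f g) (f' g)) \<epsilon> g n)"
    using M by blast
qed

lemma (in monoid) bohr_const: "bohr G (\<lambda>g. c)"
  unfolding bohr_def near_translates_def bounded_iff
  by (auto intro!: exI[of _ "{\<one>}"])

lemma (in monoid) bohr_linear:
  assumes "bohr G f" "bohr G f'"
  shows "bohr G (\<lambda>g. a * f g + f' g)"
proof (rule bohr_lipschitz[OF assms, where F = "\<lambda>x y. a * x + y" and L = "norm a + 1"])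
  fix x y x' y' :: complex
  have "norm (a * x + y - (a * x' + y')) = norm (a * (x - x') + (y - y'))"
    by (simp add: algebra_simps)
  also have "\<dots> \<le> norm a * norm (x - x') + norm (y - y')"
    by (metis norm_mult norm_triangle_ineq)
  also have "\<dots> \<le> (norm a + 1) * (norm (x - x') + norm (y - y'))"
    by (simp add: algebra_simps)
  finally show "norm (a * x + y - (a * x' + y')) \<le> (norm a + 1) * (norm (x - x') + norm (y - y'))" .
qed

lemma (in monoid) bohr_Re:
  assumes "bohr G f"
  shows "bohr G (\<lambda>g. complex_of_real (Re (f g)))"
proof (rule bohr_lipschitz[OF assms assms, where F = "\<lambda>x y. complex_of_real (Re x)" and L = 1])
  fix x y x' y' :: complex
  have "norm (complex_of_real (Re x) - complex_of_real (Re x')) = \<bar>Re (x - x')\<bar>"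
    by (metis minus_complex.sel norm_of_real of_real_diff)
  also have "\<dots> \<le> norm (x - x')"
    by (rule abs_Re_le_cmod)
  also have "\<dots> \<le> 1 * (norm (x - x') + norm (y - y'))"
    by simp
  finally show "norm (complex_of_real (Re x) - complex_of_real (Re x')) \<le> 1 * (norm (x - x') + norm (y - y'))" .
qed

lemma (in monoid) bohr_Im:
  assumes "bohr G f"
  shows "bohr G (\<lambda>g. complex_of_real (Im (f g)))"
proof (rule bohr_lipschitz[OF assms assms, where F = "\<lambda>x y. complex_of_real (Im x)" and L = 1])
  fix x y x' y' :: complex
  have "norm (complex_of_real (Im x) - complex_of_real (Im x')) = \<bar>Im (x - x')\<bar>"
    by (metis minus_complex.sel norm_of_real of_real_diff)
  also have "\<dots> \<le> norm (x - x')"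
    by (rule abs_Im_le_cmod)
  also have "\<dots> \<le> 1 * (norm (x - x') + norm (y - y'))"
    by simp
  finally show "norm (complex_of_real (Im x) - complex_of_real (Im x')) \<le> 1 * (norm (x - x') + norm (y - y'))" .
qed

section \<open>Total boundedness of translates and its two-sided form\<close>

lemma (in monoid) translate_in_fspace:
  assumes "bounded (f ` carrier G)" "g \<in> carrier G"
  shows "translate G g f \<in> Met_TC.fspace (carrier G)"
proof -
  have "translate G g f ` carrier G \<subseteq> f ` carrier G"
    using assms(2) by (auto simp: translate_def)
  then show ?thesis
    using bounded_subset[OF assms(1)] by (simp add: Met_TC.fspace_def translate_def)
qed

lemma (in monoid) fdist_translate_le:
  assumes "bounded (f ` carrier G)" "g \<in> carrier G" "g' \<in> carrier G"
  shows "Met_TC.fdist (carrier G) (translate G g f) (translate G g' f) \<le> \<epsilon> \<longleftrightarrow>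
    (\<forall>h\<in>carrier G. norm (f (h \<otimes> g) - f (h \<otimes> g')) \<le> \<epsilon>)"
proof -
  have "Met_TC.fdist (carrier G) (translate G g f) (translate G g' f) \<le> \<epsilon> \<longleftrightarrow>
      (\<forall>h\<in>carrier G. dist (translate G g f h) (translate G g' f h) \<le> \<epsilon>)"
    using assms one_closed by (intro Met_TC.funspace_mdist_le translate_in_fspace) auto
  then show ?thesis
    by (simp add: translate_def dist_norm)
qed

lemma (in monoid) almost_periodicI:
  assumes "f \<in> extensional (carrier G)" and bdd: "bounded (f ` carrier G)"
    and net: "\<And>\<epsilon>. \<epsilon> > 0 \<Longrightarrow> \<exists>N\<subseteq>carrier G. finite N \<and>
      (\<forall>g\<in>carrier G. \<exists>n\<in>N. \<forall>h\<in>carrier G. norm (f (h \<otimes> g) - f (h \<otimes> n)) \<le> \<epsilon>)"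
  shows "f \<in> almost_periodic G"
proof -
  interpret F: Metric_space "Met_TC.fspace (carrier G)" "Met_TC.fdist (carrier G)"
    by (rule Met_TC.Metric_space_funspace)
  have "F.mtotally_bounded ((\<lambda>g. translate G g f) ` carrier G)"
    unfolding F.mtotally_bounded_def
  proof (intro allI impI)
    fix \<epsilon> :: real
    assume "\<epsilon> > 0"
    \<comment> \<open>Half of \<open>\<epsilon>\<close>, because the balls to be covered with are
      open while the net estimate is not strict.\<close>
    then obtain N where N: "N \<subseteq> carrier G" "finite N"
      "\<And>g. g \<in> carrier G \<Longrightarrow> \<exists>n\<in>N. \<forall>h\<in>carrier G. norm (f (h \<otimes> g) - f (h \<otimes> n)) \<le> \<epsilon> / 2"
      using net[of "\<epsilon> / 2"] by auto
    have "\<exists>n\<in>N. translate G g f \<in> F.mball (translate G n f) \<epsilon>" if g: "g \<in> carrier G" for g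
    proof -
      obtain n where n: "n \<in> N" "\<And>h. h \<in> carrier G \<Longrightarrow> norm (f (h \<otimes> g) - f (h \<otimes> n)) \<le> \<epsilon> / 2"
        using N(3)[OF g] by auto
      then have nG: "n \<in> carrier G"
        using N(1) by auto
      have "Met_TC.fdist (carrier G) (translate G n f) (translate G g f) \<le> \<epsilon> / 2"
        unfolding fdist_translate_le[OF bdd nG g] using n(2) by (simp add: norm_minus_commute)
      then show ?thesis
        using n(1) nG g \<open>\<epsilon> > 0\<close> translate_in_fspace[OF bdd] by (intro bexI[of _ n]) auto
    qed
    then show "\<exists>K. finite K \<and> K \<subseteq> (\<lambda>g. translate G g f) ` carrier G \<and>
        (\<lambda>g. translate G g f) ` carrier G \<subseteq> (\<Union>x\<in>K. F.mball x \<epsilon>)"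
      using N(1,2) by (intro exI[of _ "(\<lambda>g. translate G g f) ` N"]) blast
  qed
  then show ?thesis
    using assms(1) bdd by (simp add: almost_periodic_def Met_TC.fspace_def)
qed

text \<open>Total boundedness gives a finite \<open>N\<close> and a choice \<open>r k\<close> in
  \<open>N\<close> with \<open>f (h \<otimes> k)\<close> close to \<open>f (h \<otimes> r k)\<close>
  for all \<open>h\<close>. To control a middle factor \<open>g\<close>, replace first
  \<open>k\<close> by \<open>r k\<close> and then the product \<open>g \<otimes> r k\<close> by its
  own representative. What remains depends on \<open>g\<close> only through the finite table of the
  \<open>r (g \<otimes> n)\<close> with \<open>n\<close> in \<open>N\<close>.\<close>

lemma (in group) almost_periodic_iff_bohr:
  "f \<in> almost_periodic G \<longleftrightarrow> f \<in> extensional (carrier G) \<and> bohr G f"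
proof (cases "f \<in> extensional (carrier G) \<and> bounded (f ` carrier G)")
  case True
  interpret F: Metric_space "Met_TC.fspace (carrier G)" "Met_TC.fdist (carrier G)"
    by (rule Met_TC.Metric_space_funspace)
  note bdd = conjunct2[OF True]
  have f: "f \<in> Met_TC.fspace (carrier G)"
    using True by (simp add: Met_TC.fspace_def)
  have "bohr G f" if tb: "F.mtotally_bounded ((\<lambda>g. translate G g f) ` carrier G)"
    unfolding bohr_def
  proof (intro conjI allI impI)
    fix \<epsilon> :: real
    assume "\<epsilon> > 0"
    then obtain K where K: "finite K" "K \<subseteq> (\<lambda>g. translate G g f) ` carrier G"
      "(\<lambda>g. translate G g f) ` carrier G \<subseteq> (\<Union>x\<in>K. F.mball x (\<epsilon> / 4))"
      using tb unfolding F.mtotally_bounded_def by (meson divide_pos_pos zero_less_numeral)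
    obtain N where N: "N \<subseteq> carrier G" "finite N" "K = (\<lambda>g. translate G g f) ` N"
      using finite_subset_image[OF K(1,2)] by blast
    have "\<exists>n\<in>N. \<forall>h\<in>carrier G. norm (f (h \<otimes> k) - f (h \<otimes> n)) \<le> \<epsilon> / 4" if k: "k \<in> carrier G" for k
    proof -
      obtain n where n: "n \<in> N" "translate G k f \<in> F.mball (translate G n f) (\<epsilon> / 4)"
        using K(3) k N(3) by fastforce
      then have "Met_TC.fdist (carrier G) (translate G k f) (translate G n f) \<le> \<epsilon> / 4"
        by (simp add: F.commute less_imp_le)
      then show ?thesis
        using n(1) N(1) k fdist_translate_le[OF bdd] by blast
    qed
    then obtain r where r: "\<And>k. k \<in> carrier G \<Longrightarrow> r k \<in> N"
      "\<And>h k. k \<in> carrier G \<Longrightarrow> h \<in> carrier G \<Longrightarrow> norm (f (h \<otimes> k) - f (h \<otimes> r k)) \<le> \<epsilon> / 4"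
      by metis
    \<comment> \<open>The colour of \<open>g\<close> is its table of representatives, a map from
      \<open>N\<close> to \<open>N\<close>; there are finitely many.\<close>
    have "(\<lambda>g. \<lambda>n\<in>N. r (g \<otimes> n)) ` carrier G \<subseteq> N \<rightarrow>\<^sub>E N"
      using r(1) N(1) by auto
    then have fin: "finite ((\<lambda>g. \<lambda>n\<in>N. r (g \<otimes> n)) ` carrier G)"
      using N(2) by (meson finite_PiE finite_subset)
    then obtain M where M: "M \<subseteq> carrier G" "finite M"
      "\<And>g. g \<in> carrier G \<Longrightarrow> \<exists>m\<in>M. (\<lambda>n\<in>N. r (g \<otimes> n)) = (\<lambda>n\<in>N. r (m \<otimes> n))"
      using finite_representatives[OF fin] by auto
    have "\<exists>m\<in>M. near_translates G f \<epsilon> g m" if g: "g \<in> carrier G" for g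
    proof -
      obtain m where m: "m \<in> M" "(\<lambda>n\<in>N. r (g \<otimes> n)) = (\<lambda>n\<in>N. r (m \<otimes> n))"
        using M(3)[OF g] by auto
      have eq: "r (g \<otimes> n) = r (m \<otimes> n)" if "n \<in> N" for n
        using fun_cong[OF m(2), of n] that by simp
      have mG: "m \<in> carrier G"
        using m M by auto
      have "norm (f (h \<otimes> g \<otimes> k) - f (h \<otimes> m \<otimes> k)) \<le> \<epsilon>" if hk: "h \<in> carrier G" "k \<in> carrier G" for h k
      proof -
        note rk = subsetD[OF N(1) r(1)[OF hk(2)]]
        \<comment> \<open>Two replacements of cost \<open>\<epsilon> / 4\<close> each. This is used
          for \<open>g\<close> and for \<open>m\<close>, whose end points agree since the tables
          agree.\<close>
        have near: "norm (f (h \<otimes> x \<otimes> k) - f (h \<otimes> r (x \<otimes> r k))) \<le> \<epsilon> / 2" if x: "x \<in> carrier G" for x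
        proof -
          have "norm (f (h \<otimes> x \<otimes> k) - f (h \<otimes> x \<otimes> r k)) \<le> \<epsilon> / 4"
            using r(2)[OF hk(2), of "h \<otimes> x"] hk x by simp
          moreover have "norm (f (h \<otimes> x \<otimes> r k) - f (h \<otimes> r (x \<otimes> r k))) \<le> \<epsilon> / 4"
            using r(2)[of "x \<otimes> r k" h] hk x rk by (simp add: m_assoc)
          ultimately show ?thesis
            using norm_triangle_ineq[of "f (h \<otimes> x \<otimes> k) - f (h \<otimes> x \<otimes> r k)"
                "f (h \<otimes> x \<otimes> r k) - f (h \<otimes> r (x \<otimes> r k))"] by simp
        qed
        show ?thesis
          using norm_diff_le_via[OF near[OF g]] near[OF mG] eq[OF r(1)[OF hk(2)]] by simp
      qed
      then show ?thesis
        using m(1) by (auto simp: near_translates_def)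
    qed
    then show "\<exists>N\<subseteq>carrier G. finite N \<and> (\<forall>g\<in>carrier G. \<exists>n\<in>N. near_translates G f \<epsilon> g n)"
      using M by blast
  qed (rule bdd)
  moreover have "f \<in> almost_periodic G" if b: "bohr G f"
  proof (rule almost_periodicI)
    fix \<epsilon> :: real
    assume "\<epsilon> > 0"
    obtain N where N: "N \<subseteq> carrier G" "finite N"
      "\<And>g. g \<in> carrier G \<Longrightarrow> \<exists>n\<in>N. near_translates G f \<epsilon> g n"
      using bohr_net[OF b \<open>\<epsilon> > 0\<close>] by auto
    have "\<exists>n\<in>N. \<forall>h\<in>carrier G. norm (f (h \<otimes> g) - f (h \<otimes> n)) \<le> \<epsilon>" if g: "g \<in> carrier G" for g
    proof -
      obtain n where n: "n \<in> N" "near_translates G f \<epsilon> g n"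
        using N(3)[OF g] by auto
      then have nG: "n \<in> carrier G"
        using N(1) by auto
      have "norm (f (h \<otimes> g) - f (h \<otimes> n)) \<le> \<epsilon>" if h: "h \<in> carrier G" for h
      proof -
        \<comment> \<open>The one-sided condition is the case in which the factor on the right is
          \<open>\<one>\<close>.\<close>
        have "norm (f (h \<otimes> g \<otimes> \<one>) - f (h \<otimes> n \<otimes> \<one>)) \<le> \<epsilon>"
          using n(2) h one_closed unfolding near_translates_def by blast
        then show ?thesis
          using g h nG by simp
      qed
      then show ?thesis
        using n(1) by auto
    qed
    then show "\<exists>N\<subseteq>carrier G. finite N \<and>
        (\<forall>g\<in>carrier G. \<exists>n\<in>N. \<forall>h\<in>carrier G. norm (f (h \<otimes> g) - f (h \<otimes> n)) \<le> \<epsilon>)"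
      using N(1,2) by auto
  qed (use True in auto)
  ultimately show ?thesis
    using True f by (auto simp: almost_periodic_def)
next
  case False
  then show ?thesis
    by (auto simp: almost_periodic_def Met_TC.fspace_def bohr_def)
qed

lemma (in group) restrict_almost_periodic:
  assumes "bohr G f"
  shows "restrict f (carrier G) \<in> almost_periodic G"
  unfolding almost_periodic_iff_bohr using bohr_cong[OF assms, of "restrict f (carrier G)"] by simp

section \<open>The invariant mean\<close>

abbreviation left_averages :: "('g, 'c) monoid_scheme \<Rightarrow> (('g \<Rightarrow> complex) \<Rightarrow> 'g \<Rightarrow> complex) set" where
  "left_averages G \<equiv> averages (carrier G) (\<lambda>k h. k \<otimes>\<^bsub>G\<^esub> h)"

abbreviation right_averages :: "('g, 'c) monoid_scheme \<Rightarrow> (('g \<Rightarrow> complex) \<Rightarrow> 'g \<Rightarrow> complex) set" where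
  "right_averages G \<equiv> averages (carrier G) (\<lambda>k h. h \<otimes>\<^bsub>G\<^esub> k)"

text \<open>The constant \<open>c\<close> is a uniform limit of averages of \<open>f\<close>.
  Uniqueness of \<open>c\<close> is not part of the notion; it comes from confronting left values
  with right values.\<close>

definition average_value ::
    "(('s \<Rightarrow> complex) \<Rightarrow> 's \<Rightarrow> complex) set \<Rightarrow> 's set \<Rightarrow> ('s \<Rightarrow> complex) \<Rightarrow> complex \<Rightarrow> bool" where
  "average_value \<A> S f c \<longleftrightarrow> (\<forall>\<epsilon>>0. \<exists>T\<in>\<A>. \<forall>x\<in>S. norm (T f x - c) \<le> \<epsilon>)"

lemma average_value_cong:
  assumes "average_value (averages I \<tau>) S f c"
    and "\<And>i x. i \<in> I \<Longrightarrow> x \<in> S \<Longrightarrow> \<tau> i x \<in> S" and "\<And>x. x \<in> S \<Longrightarrow> f x = g x"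
  shows "average_value (averages I \<tau>) S g c"
  unfolding average_value_def
proof (intro allI impI)
  fix \<epsilon> :: real
  assume "\<epsilon> > 0"
  then obtain T where T: "T \<in> averages I \<tau>" "\<And>x. x \<in> S \<Longrightarrow> norm (T f x - c) \<le> \<epsilon>"
    using assms(1) by (auto simp: average_value_def)
  have "T f x = T g x" if "x \<in> S" for x
    using averages_cong[OF T(1), of S f g x] assms(2,3) that by auto
  then show "\<exists>T\<in>averages I \<tau>. \<forall>x\<in>S. norm (T g x - c) \<le> \<epsilon>"
    using T by (intro bexI[of _ T]) auto
qed

section \<open>Left and right averages of almost periodic functions\<close>

lemma (in group) left_right_averages_commute:
  assumes "T \<in> left_averages G" "U \<in> right_averages G" "x \<in> carrier G"
  shows "T (U f) x = U (T f) x"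
  by (rule averages_commute[OF assms(1,2), of "carrier G"]) (use assms(3) in \<open>auto simp: m_assoc\<close>)

text \<open>A further left factor \<open>n\<close> is absorbed into the universally quantified
  \<open>h\<close>, as \<open>n \<otimes> (h \<otimes> g \<otimes> k) = (n \<otimes> h) \<otimes> g
  \<otimes> k\<close>. So averaging costs nothing in \<open>\<epsilon>\<close>, and one net for
  \<open>f\<close> serves all its averages. On the right the factor is absorbed into
  \<open>k\<close>.\<close>

lemma (in group) near_translates_left_average:
  assumes "T \<in> left_averages G" "near_translates G f \<epsilon> g g'" "g \<in> carrier G" "g' \<in> carrier G"
  shows "near_translates G (T f) \<epsilon> g g'"
  using assms(1)
proof (induction rule: averages.induct)
  case (step T N)
  have "norm (trans_avg (\<otimes>) N (T f) (h \<otimes> g \<otimes> k) - trans_avg (\<otimes>) N (T f) (h \<otimes> g' \<otimes> k)) \<le> \<epsilon>"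
    if "h \<in> carrier G" "k \<in> carrier G" for h k
  proof (rule trans_avg_diff)
    show "norm (T f (n \<otimes> (h \<otimes> g \<otimes> k)) - T f (n \<otimes> (h \<otimes> g' \<otimes> k))) \<le> \<epsilon>" if "n \<in> N" for n
    proof -
      have n: "n \<in> carrier G"
        using that step by auto
      then have "norm (T f ((n \<otimes> h) \<otimes> g \<otimes> k) - T f ((n \<otimes> h) \<otimes> g' \<otimes> k)) \<le> \<epsilon>"
        using step.IH \<open>h \<in> _\<close> \<open>k \<in> _\<close> by (simp add: near_translates_def)
      then show ?thesis
        using n \<open>h \<in> _\<close> \<open>k \<in> _\<close> assms(3,4) by (simp add: m_assoc)
    qed
  qed (use step in auto)
  then show ?case
    by (simp add: near_translates_def)
qed (use assms in auto)

lemma (in group) near_translates_right_average: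
  assumes "T \<in> right_averages G" "near_translates G f \<epsilon> g g'" "g \<in> carrier G" "g' \<in> carrier G"
  shows "near_translates G (T f) \<epsilon> g g'"
  using assms(1)
proof (induction rule: averages.induct)
  case (step T N)
  have "norm (trans_avg (\<lambda>k h. h \<otimes> k) N (T f) (h \<otimes> g \<otimes> k)
      - trans_avg (\<lambda>k h. h \<otimes> k) N (T f) (h \<otimes> g' \<otimes> k)) \<le> \<epsilon>"
    if "h \<in> carrier G" "k \<in> carrier G" for h k
  proof (rule trans_avg_diff)
    show "norm (T f (h \<otimes> g \<otimes> k \<otimes> n) - T f (h \<otimes> g' \<otimes> k \<otimes> n)) \<le> \<epsilon>" if "n \<in> N" for n
    proof -
      have n: "n \<in> carrier G"
        using that step by auto
      then have "norm (T f (h \<otimes> g \<otimes> (k \<otimes> n)) - T f (h \<otimes> g' \<otimes> (k \<otimes> n))) \<le> \<epsilon>"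
        using step.IH \<open>h \<in> _\<close> \<open>k \<in> _\<close> by (simp add: near_translates_def)
      then show ?thesis
        using n \<open>h \<in> _\<close> \<open>k \<in> _\<close> assms(3,4) by (simp add: m_assoc)
    qed
  qed (use step in auto)
  then show ?case
    by (simp add: near_translates_def)
qed (use assms in auto)

lemma (in group) bohr_net_nonempty:
  assumes "bohr G f" "\<epsilon> > 0"
  obtains N where "finite N" "N \<noteq> {}" "N \<subseteq> carrier G"
    "\<And>g. g \<in> carrier G \<Longrightarrow> \<exists>n\<in>N. near_translates G f \<epsilon> g n"
proof -
  obtain N where N: "N \<subseteq> carrier G" "finite N"
    "\<And>g. g \<in> carrier G \<Longrightarrow> \<exists>n\<in>N. near_translates G f \<epsilon> g n"
    using bohr_net[OF assms] by auto
  moreover have "N \<noteq> {}"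
    using N(3)[OF one_closed] by auto
  ultimately show thesis
    using that by auto
qed

lemma (in group) bohr_right_average:
  assumes "bohr G f" "T \<in> right_averages G"
  shows "bohr G (T f)"
  unfolding bohr_def
proof (intro conjI allI impI)
  obtain B where B: "\<And>g. g \<in> carrier G \<Longrightarrow> norm (f g) \<le> B"
    using bohr_bound[OF assms(1)] by auto
  have "norm (T f x - 0) \<le> B" if "x \<in> carrier G" for x
    by (rule averages_near[OF assms(2), of "carrier G"]) (use B that in auto)
  then show "bounded (T f ` carrier G)"
    by (auto simp: bounded_iff)
next
  fix \<epsilon> :: real
  assume "\<epsilon> > 0"
  obtain N where N: "N \<subseteq> carrier G" "finite N"
    "\<And>g. g \<in> carrier G \<Longrightarrow> \<exists>n\<in>N. near_translates G f \<epsilon> g n"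
    using bohr_net[OF assms(1) \<open>\<epsilon> > 0\<close>] by auto
  then have "\<exists>n\<in>N. near_translates G (T f) \<epsilon> g n" if "g \<in> carrier G" for g
    using near_translates_right_average[OF assms(2)] that by (meson subsetD)
  then show "\<exists>N\<subseteq>carrier G. finite N \<and> (\<forall>g\<in>carrier G. \<exists>n\<in>N. near_translates G (T f) \<epsilon> g n)"
    using N(1,2) by auto
qed

lemma (in group) left_average_almost_constant:
  assumes f: "bohr G f" and "\<epsilon> > 0"
  shows "\<exists>T\<in>left_averages G. \<exists>c. \<forall>x\<in>carrier G. norm (T f x - c) \<le> \<epsilon>"
proof -
  obtain B where B: "\<And>g. g \<in> carrier G \<Longrightarrow> norm (f g) \<le> B"
    using bohr_bound[OF f] by auto
  show ?thesis
  proof (rule averages_almost_constant)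
    show "\<exists>i\<in>carrier G. i \<otimes> x = y" if "x \<in> carrier G" "y \<in> carrier G" for x y
      using that by (intro bexI[of _ "y \<otimes> inv x"]) (auto simp: m_assoc)
    show "\<exists>N. finite N \<and> N \<noteq> {} \<and> N \<subseteq> carrier G \<and>
        (\<forall>i\<in>carrier G. \<exists>n\<in>N. \<forall>T\<in>left_averages G. \<forall>x\<in>carrier G.
          norm (T f (i \<otimes> x) - T f (n \<otimes> x)) \<le> \<delta>)" if "\<delta> > 0" for \<delta>
    proof -
      obtain N where N: "finite N" "N \<noteq> {}" "N \<subseteq> carrier G"
        "\<And>g. g \<in> carrier G \<Longrightarrow> \<exists>n\<in>N. near_translates G f \<delta> g n"
        using bohr_net_nonempty[OF f \<open>\<delta> > 0\<close>] by auto
      have "\<exists>n\<in>N. \<forall>T\<in>left_averages G. \<forall>x\<in>carrier G. norm (T f (i \<otimes> x) - T f (n \<otimes> x)) \<le> \<delta>"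
        if i: "i \<in> carrier G" for i
      proof -
        obtain n where n: "n \<in> N" "near_translates G f \<delta> i n"
          using N(4)[OF i] by auto
        then have nG: "n \<in> carrier G"
          using N(3) by auto
        have "norm (T f (i \<otimes> x) - T f (n \<otimes> x)) \<le> \<delta>"
          if T: "T \<in> left_averages G" and x: "x \<in> carrier G" for T x
        proof -
          \<comment> \<open>With \<open>\<one>\<close> as the left factor, nearness in the middle
            becomes nearness of left translates of \<open>T f\<close>.\<close>
          have "norm (T f (\<one> \<otimes> i \<otimes> x) - T f (\<one> \<otimes> n \<otimes> x)) \<le> \<delta>"
            using near_translates_left_average[OF T n(2) i nG] x one_closed
            unfolding near_translates_def by blast
          then show ?thesis
            using i nG by simp
        qed
        then show ?thesis
          using n(1) by auto
      qed
      then show ?thesis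
        using N(1-3) by auto
    qed
  qed (use B \<open>\<epsilon> > 0\<close> in auto)
qed

lemma (in group) right_average_almost_constant:
  assumes f: "bohr G f" and "\<epsilon> > 0"
  shows "\<exists>T\<in>right_averages G. \<exists>c. \<forall>x\<in>carrier G. norm (T f x - c) \<le> \<epsilon>"
proof -
  obtain B where B: "\<And>g. g \<in> carrier G \<Longrightarrow> norm (f g) \<le> B"
    using bohr_bound[OF f] by auto
  show ?thesis
  proof (rule averages_almost_constant)
    show "\<exists>i\<in>carrier G. x \<otimes> i = y" if "x \<in> carrier G" "y \<in> carrier G" for x y
      using that by (intro bexI[of _ "inv x \<otimes> y"]) (auto simp flip: m_assoc)
    show "\<exists>N. finite N \<and> N \<noteq> {} \<and> N \<subseteq> carrier G \<and>
        (\<forall>i\<in>carrier G. \<exists>n\<in>N. \<forall>T\<in>right_averages G. \<forall>x\<in>carrier G.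
          norm (T f (x \<otimes> i) - T f (x \<otimes> n)) \<le> \<delta>)" if "\<delta> > 0" for \<delta>
    proof -
      obtain N where N: "finite N" "N \<noteq> {}" "N \<subseteq> carrier G"
        "\<And>g. g \<in> carrier G \<Longrightarrow> \<exists>n\<in>N. near_translates G f \<delta> g n"
        using bohr_net_nonempty[OF f \<open>\<delta> > 0\<close>] by auto
      have "\<exists>n\<in>N. \<forall>T\<in>right_averages G. \<forall>x\<in>carrier G. norm (T f (x \<otimes> i) - T f (x \<otimes> n)) \<le> \<delta>"
        if i: "i \<in> carrier G" for i
      proof -
        obtain n where n: "n \<in> N" "near_translates G f \<delta> i n"
          using N(4)[OF i] by auto
        then have nG: "n \<in> carrier G"
          using N(3) by auto
        have "norm (T f (x \<otimes> i) - T f (x \<otimes> n)) \<le> \<delta>"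
          if T: "T \<in> right_averages G" and x: "x \<in> carrier G" for T x
        proof -
          have "norm (T f (x \<otimes> i \<otimes> \<one>) - T f (x \<otimes> n \<otimes> \<one>)) \<le> \<delta>"
            using near_translates_right_average[OF T n(2) i nG] x one_closed
            unfolding near_translates_def by blast
          then show ?thesis
            using i nG x by simp
        qed
        then show ?thesis
          using n(1) by auto
      qed
      then show ?thesis
        using N(1-3) by auto
    qed
  qed (use B \<open>\<epsilon> > 0\<close> in auto)
qed

section \<open>The common limit of left and right averages\<close>

lemma (in group) left_right_average_near:
  assumes T: "T \<in> left_averages G" "\<And>x. x \<in> carrier G \<Longrightarrow> norm (T f x - c) \<le> \<epsilon>"
    and U: "U \<in> right_averages G" "\<And>x. x \<in> carrier G \<Longrightarrow> norm (U f x - d) \<le> \<delta>"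
  shows "norm (c - d) \<le> \<epsilon> + \<delta>"
proof -
  \<comment> \<open>Averaging an almost constant function keeps it near the same constant. So the
    single number \<open>U (T f) \<one> = T (U f) \<one>\<close> is close both to \<open>c\<close>
    and to \<open>d\<close>.\<close>
  have "norm (U (T f) \<one> - c) \<le> \<epsilon>"
    by (rule averages_near[OF U(1), of "carrier G"]) (use T in auto)
  moreover have "norm (T (U f) \<one> - d) \<le> \<delta>"
    by (rule averages_near[OF T(1), of "carrier G"]) (use U in auto)
  ultimately show ?thesis
    using left_right_averages_commute[OF T(1) U(1) one_closed, of f]
      norm_triangle_ineq4[of "U (T f) \<one> - d" "U (T f) \<one> - c"] by simp
qed

lemma (in group) left_right_average_value_eq:
  assumes "average_value (left_averages G) (carrier G) f c"
    and "average_value (right_averages G) (carrier G) f d"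
  shows "c = d"
proof -
  have "norm (c - d) \<le> 0 + \<epsilon>" if "\<epsilon> > 0" for \<epsilon>
  proof -
    obtain T where T: "T \<in> left_averages G" "\<And>x. x \<in> carrier G \<Longrightarrow> norm (T f x - c) \<le> \<epsilon> / 2"
      using assms(1) \<open>\<epsilon> > 0\<close> unfolding average_value_def by (meson half_gt_zero)
    obtain U where U: "U \<in> right_averages G" "\<And>x. x \<in> carrier G \<Longrightarrow> norm (U f x - d) \<le> \<epsilon> / 2"
      using assms(2) \<open>\<epsilon> > 0\<close> unfolding average_value_def by (meson half_gt_zero)
    show ?thesis
      using left_right_average_near[OF T U] by simp
  qed
  then have "norm (c - d) \<le> 0"
    by (rule field_le_epsilon)
  then show ?thesis
    by simp
qed

text \<open>Approximate constants \<open>c n\<close> from the left and \<open>d n\<close> from the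
  right are close to each other across the sides. This makes the left constants Cauchy, and their
  limit is also approached from the right.\<close>

lemma (in group) ex_average_value:
  assumes f: "bohr G f"
  shows "\<exists>c. average_value (left_averages G) (carrier G) f c \<and>
    average_value (right_averages G) (carrier G) f c"
proof -
  define \<epsilon> where "\<epsilon> n = inverse (real (Suc n))" for n
  have \<epsilon>: "\<epsilon> n > 0" for n
    by (simp add: \<epsilon>_def)
  have "\<forall>n. \<exists>T c. T \<in> left_averages G \<and> (\<forall>x\<in>carrier G. norm (T f x - c) \<le> \<epsilon> n)"
    using left_average_almost_constant[OF f \<epsilon>] by blast
  then obtain T c where "\<forall>n. T n \<in> left_averages G \<and> (\<forall>x\<in>carrier G. norm (T n f x - c n) \<le> \<epsilon> n)"
    unfolding choice_iff by blast
  then have T: "\<And>n. T n \<in> left_averages G"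
    "\<And>n x. x \<in> carrier G \<Longrightarrow> norm (T n f x - c n) \<le> \<epsilon> n"
    by auto
  have "\<forall>n. \<exists>U d. U \<in> right_averages G \<and> (\<forall>x\<in>carrier G. norm (U f x - d) \<le> \<epsilon> n)"
    using right_average_almost_constant[OF f \<epsilon>] by blast
  then obtain U d where "\<forall>n. U n \<in> right_averages G \<and> (\<forall>x\<in>carrier G. norm (U n f x - d n) \<le> \<epsilon> n)"
    unfolding choice_iff by blast
  then have U: "\<And>n. U n \<in> right_averages G"
    "\<And>n x. x \<in> carrier G \<Longrightarrow> norm (U n f x - d n) \<le> \<epsilon> n"
    by auto
  have cd: "norm (c m - d n) \<le> \<epsilon> m + \<epsilon> n" for m n
    by (rule left_right_average_near[OF T(1)[of m] T(2)[of _ m] U(1)[of n] U(2)[of _ n]])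
  have lim_\<epsilon>: "\<epsilon> \<longlonglongrightarrow> 0"
    unfolding \<epsilon>_def by (rule LIMSEQ_inverse_real_of_nat)
  \<comment> \<open>Two left constants can only be compared through a right one, \<open>d k\<close>.
    The extra error \<open>2 * \<epsilon> k\<close> disappears as \<open>k\<close> grows.\<close>
  have c_diff: "norm (c m - c n) \<le> \<epsilon> m + \<epsilon> n" for m n
  proof (rule field_le_epsilon)
    fix e :: real
    assume "e > 0"
    then have "\<forall>\<^sub>F k in sequentially. \<epsilon> k < e / 2"
      using lim_\<epsilon> by (intro order_tendstoD) auto
    then obtain k where "\<epsilon> k < e / 2"
      using eventually_happens'[OF sequentially_bot] by blast
    then show "norm (c m - c n) \<le> \<epsilon> m + \<epsilon> n + e"
      using cd[of m k] cd[of n k] norm_triangle_ineq4[of "c m - d k" "c n - d k"] by simp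
  qed
  have "Cauchy c"
  proof (rule metric_CauchyI)
    fix e :: real
    assume "e > 0"
    then have "\<forall>\<^sub>F k in sequentially. \<epsilon> k < e / 2"
      using lim_\<epsilon> by (intro order_tendstoD) auto
    then obtain K where "\<And>k. k \<ge> K \<Longrightarrow> \<epsilon> k < e / 2"
      by (auto simp: eventually_sequentially)
    then have "dist (c m) (c n) < e" if "m \<ge> K" "n \<ge> K" for m n
      using c_diff[of m n] add_strict_mono[of "\<epsilon> m" "e / 2" "\<epsilon> n" "e / 2"] that
      by (simp add: dist_norm)
    then show "\<exists>M. \<forall>m\<ge>M. \<forall>n\<ge>M. dist (c m) (c n) < e"
      by blast
  qed
  then obtain l where l: "c \<longlonglongrightarrow> l"
    using Cauchy_convergent convergent_def by blast
  \<comment> \<open>Quarters, because the right side accumulates \<open>\<epsilon> n\<close> from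
    \<open>U n\<close>, \<open>2 * \<epsilon> n\<close> from \<open>c n - d n\<close>, and the
    distance of \<open>c n\<close> to \<open>l\<close>.\<close>
  have near: "\<exists>n. norm (c n - l) \<le> e / 4 \<and> \<epsilon> n \<le> e / 4" if "e > 0" for e
  proof -
    have "\<forall>\<^sub>F n in sequentially. dist (c n) l < e / 4"
      using l \<open>e > 0\<close> by (intro tendstoD) auto
    moreover have "\<forall>\<^sub>F n in sequentially. \<epsilon> n < e / 4"
      using lim_\<epsilon> \<open>e > 0\<close> by (intro order_tendstoD) auto
    ultimately have "\<forall>\<^sub>F n in sequentially. norm (c n - l) \<le> e / 4 \<and> \<epsilon> n \<le> e / 4"
      by eventually_elim (simp add: dist_norm)
    then show ?thesis
      by (rule eventually_happens'[OF sequentially_bot])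
  qed
  have "average_value (left_averages G) (carrier G) f l"
    unfolding average_value_def
  proof (intro allI impI)
    fix e :: real
    assume "e > 0"
    obtain n where n: "norm (c n - l) \<le> e / 4" "\<epsilon> n \<le> e / 4"
      using near[OF \<open>e > 0\<close>] by auto
    have "norm (T n f x - l) \<le> e" if "x \<in> carrier G" for x
      using norm_triangle_ineq[of "T n f x - c n" "c n - l"] T(2)[OF that, of n] n \<open>e > 0\<close> by simp
    then show "\<exists>T\<in>left_averages G. \<forall>x\<in>carrier G. norm (T f x - l) \<le> e"
      using T(1) by blast
  qed
  moreover have "average_value (right_averages G) (carrier G) f l"
    unfolding average_value_def
  proof (intro allI impI)
    fix e :: real
    assume "e > 0"
    obtain n where n: "norm (c n - l) \<le> e / 4" "\<epsilon> n \<le> e / 4"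
      using near[OF \<open>e > 0\<close>] by auto
    have "norm (U n f x - l) \<le> e" if "x \<in> carrier G" for x
    proof -
      have "norm (U n f x - l) \<le> norm (U n f x - d n) + norm (c n - d n) + norm (c n - l)"
        using norm_triangle_ineq[of "U n f x - d n" "d n - l"]
          norm_triangle_ineq4[of "c n - l" "c n - d n"] by simp
      then show ?thesis
        using U(2)[OF that, of n] cd[of n n] n by simp
    qed
    then show "\<exists>T\<in>right_averages G. \<forall>x\<in>carrier G. norm (T f x - l) \<le> e"
      using U(1) by blast
  qed
  ultimately show ?thesis
    by blast
qed

text \<open>The choice is harmless, since left and right values agree. Demanding both sides allows
  the mean to be identified from either one.\<close>

definition bohr_mean :: "('g, 'c) monoid_scheme \<Rightarrow> ('g \<Rightarrow> complex) \<Rightarrow> complex" where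
  "bohr_mean G f = (SOME c. average_value (left_averages G) (carrier G) f c \<and>
    average_value (right_averages G) (carrier G) f c)"

lemma (in group) average_value_bohr_mean:
  assumes "bohr G f"
  shows "average_value (left_averages G) (carrier G) f (bohr_mean G f)"
    and "average_value (right_averages G) (carrier G) f (bohr_mean G f)"
  using someI_ex[OF ex_average_value[OF assms]] by (auto simp: bohr_mean_def)

text \<open>A value found on one side suffices, because it is compared with the value that the mean
  has on the opposite side.\<close>

lemma (in group) bohr_mean_eqI_left:
  assumes "bohr G f" "average_value (left_averages G) (carrier G) f c"
  shows "bohr_mean G f = c"
  using left_right_average_value_eq[OF assms(2) average_value_bohr_mean(2)[OF assms(1)]] by simp

lemma (in group) bohr_mean_eqI_right:
  assumes "bohr G f" "average_value (right_averages G) (carrier G) f c"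
  shows "bohr_mean G f = c"
  using left_right_average_value_eq[OF average_value_bohr_mean(1)[OF assms(1)] assms(2)] .

lemma (in group) bohr_mean_cong:
  assumes "bohr G f" and "\<And>g. g \<in> carrier G \<Longrightarrow> f g = f' g"
  shows "bohr_mean G f' = bohr_mean G f"
proof (rule bohr_mean_eqI_right)
  show "bohr G f'"
    by (rule bohr_cong[OF assms])
  show "average_value (right_averages G) (carrier G) f' (bohr_mean G f)"
    by (rule average_value_cong[OF average_value_bohr_mean(2)[OF assms(1)]]) (use assms(2) in auto)
qed

text \<open>Left averages are decisive here: if \<open>T f\<close> is nearly constant, so is
  \<open>U (T f)\<close>, and this equals \<open>T (U f)\<close>. Right averages would not commute
  past \<open>U\<close>.\<close>

lemma (in group) bohr_mean_right_average:
  assumes f: "bohr G f" and U: "U \<in> right_averages G"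
  shows "bohr_mean G (U f) = bohr_mean G f"
proof (rule bohr_mean_eqI_left[OF bohr_right_average[OF f U]])
  show "average_value (left_averages G) (carrier G) (U f) (bohr_mean G f)"
    unfolding average_value_def
  proof (intro allI impI)
    fix \<epsilon> :: real
    assume "\<epsilon> > 0"
    then obtain T where T: "T \<in> left_averages G"
      "\<And>x. x \<in> carrier G \<Longrightarrow> norm (T f x - bohr_mean G f) \<le> \<epsilon>"
      using average_value_bohr_mean(1)[OF f] by (auto simp: average_value_def)
    have "norm (U (T f) x - bohr_mean G f) \<le> \<epsilon>" if "x \<in> carrier G" for x
      by (rule averages_near[OF U, of "carrier G"]) (use T that in auto)
    then show "\<exists>T\<in>left_averages G. \<forall>x\<in>carrier G. norm (T (U f) x - bohr_mean G f) \<le> \<epsilon>"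
      using left_right_averages_commute[OF T(1) U] T(1) by (intro bexI[of _ T]) auto
  qed
qed

lemma (in group) bohr_mean_translate:
  assumes "bohr G f" "g \<in> carrier G"
  shows "bohr G (\<lambda>h. f (h \<otimes> g))" "bohr_mean G (\<lambda>h. f (h \<otimes> g)) = bohr_mean G f"
proof -
  \<comment> \<open>Translation by \<open>g\<close> is the average over the one-element set
    \<open>{g}\<close>, so right invariance is a special case.\<close>
  have "(\<lambda>f. trans_avg (\<lambda>k h. h \<otimes> k) {g} f) \<in> right_averages G"
    using averages.step[OF averages.id, of "{g}"] assms(2) by auto
  moreover have "trans_avg (\<lambda>k h. h \<otimes> k) {g} f = (\<lambda>h. f (h \<otimes> g))"
    by (simp add: trans_avg_def fun_eq_iff)
  ultimately show "bohr G (\<lambda>h. f (h \<otimes> g))" "bohr_mean G (\<lambda>h. f (h \<otimes> g)) = bohr_mean G f"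
    using bohr_right_average[OF assms(1)] bohr_mean_right_average[OF assms(1)] by force+
qed

text \<open>The two functions need different averages, so a common one is composed: \<open>T\<close>
  flattens \<open>f\<close>, and \<open>U\<close> then flattens \<open>T f'\<close>. The mean of
  \<open>T f'\<close> is still that of \<open>f'\<close>, and \<open>U\<close> leaves
  \<open>T f\<close> near its constant.\<close>

lemma (in group) bohr_mean_linear:
  assumes f: "bohr G f" and f': "bohr G f'"
  shows "bohr_mean G (\<lambda>g. a * f g + f' g) = a * bohr_mean G f + bohr_mean G f'"
proof (rule bohr_mean_eqI_right[OF bohr_linear[OF assms]])
  let ?m = "bohr_mean G f" and ?m' = "bohr_mean G f'"
  show "average_value (right_averages G) (carrier G) (\<lambda>g. a * f g + f' g) (a * ?m + ?m')"
    unfolding average_value_def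
  proof (intro allI impI)
    fix \<epsilon> :: real
    assume "\<epsilon> > 0"
    \<comment> \<open>The errors for \<open>a * f\<close> and \<open>f'\<close> add up to
      \<open>norm a * \<delta> + \<delta>\<close>, which is \<open>\<epsilon>\<close>.\<close>
    define \<delta> where "\<delta> = \<epsilon> / (norm a + 1)"
    have "norm a + 1 > 0"
      using norm_ge_zero[of a] by linarith
    then have "\<delta> > 0" "(norm a + 1) * \<delta> = \<epsilon>"
      using \<open>\<epsilon> > 0\<close> by (simp_all add: \<delta>_def)
    then have \<delta>: "\<delta> > 0" "norm a * \<delta> + \<delta> = \<epsilon>"
      by (simp_all add: distrib_right)
    obtain T where T: "T \<in> right_averages G" "\<And>x. x \<in> carrier G \<Longrightarrow> norm (T f x - ?m) \<le> \<delta>"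
      using average_value_bohr_mean(2)[OF f] \<delta>(1) by (auto simp: average_value_def)
    obtain U where U: "U \<in> right_averages G" "\<And>x. x \<in> carrier G \<Longrightarrow> norm (U (T f') x - ?m') \<le> \<delta>"
      using average_value_bohr_mean(2)[OF bohr_right_average[OF f' T(1)]] \<delta>(1)
      unfolding bohr_mean_right_average[OF f' T(1)] by (auto simp: average_value_def)
    have "norm (U (T (\<lambda>g. a * f g + f' g)) x - (a * ?m + ?m')) \<le> \<epsilon>" if x: "x \<in> carrier G" for x
    proof -
      have "norm (U (T f) x - ?m) \<le> \<delta>"
        by (rule averages_near[OF U(1), of "carrier G"]) (use T x in auto)
      have "U (T (\<lambda>g. a * f g + f' g)) x - (a * ?m + ?m')
          = a * (U (T f) x - ?m) + (U (T f') x - ?m')"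
        by (simp only: averages_linear[OF T(1)] averages_linear[OF U(1)]) (simp add: algebra_simps)
      also have "norm \<dots> \<le> norm a * norm (U (T f) x - ?m) + norm (U (T f') x - ?m')"
        by (metis norm_mult norm_triangle_ineq)
      also have "\<dots> \<le> norm a * \<delta> + \<delta>"
        using \<open>norm (U (T f) x - ?m) \<le> \<delta>\<close> U(2)[OF x] by (intro add_mono mult_left_mono) auto
      finally show ?thesis
        using \<delta>(2) by simp
    qed
    then show "\<exists>T\<in>right_averages G. \<forall>x\<in>carrier G.
        norm (T (\<lambda>g. a * f g + f' g) x - (a * ?m + ?m')) \<le> \<epsilon>"
      by (intro bexI[OF _ averages_comp[OF U(1) T(1)]]) auto
  qed
qed

text \<open>The mean is a limit of values of averages, which lie in \<open>C\<close> by convexity.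
  Singletons give the mean of constants, the nonnegative reals positivity, and closed balls the
  contraction property.\<close>

lemma (in group) bohr_mean_closed_convex:
  assumes f: "bohr G f" and C: "convex C" "closed C" "\<And>g. g \<in> carrier G \<Longrightarrow> f g \<in> C"
  shows "bohr_mean G f \<in> C"
proof -
  have "\<exists>y\<in>C. dist y (bohr_mean G f) < \<epsilon>" if "\<epsilon> > 0" for \<epsilon>
  proof -
    obtain T where T: "T \<in> right_averages G"
      "\<And>x. x \<in> carrier G \<Longrightarrow> norm (T f x - bohr_mean G f) \<le> \<epsilon> / 2"
      using average_value_bohr_mean(2)[OF f] \<open>\<epsilon> > 0\<close> unfolding average_value_def
      by (meson half_gt_zero)
    have "T f \<one> \<in> C"
      by (rule averages_convex[OF T(1), of "carrier G"]) (use C in auto)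
    moreover have "dist (T f \<one>) (bohr_mean G f) < \<epsilon>"
      using T(2)[OF one_closed] \<open>\<epsilon> > 0\<close> by (simp add: dist_norm)
    ultimately show ?thesis
      by blast
  qed
  then show ?thesis
    using C(2) closed_approachable by blast
qed

section \<open>Uniqueness of the invariant mean\<close>

lemma cmod_le_of_real_bounds:
  assumes "complex_of_real \<epsilon> + z \<in> \<real>\<^sub>\<ge>\<^sub>0" "complex_of_real \<epsilon> - z \<in> \<real>\<^sub>\<ge>\<^sub>0"
  shows "norm z \<le> \<epsilon>"
proof -
  have "Im z = 0" "\<bar>Re z\<bar> \<le> \<epsilon>"
    using assms by (auto simp: complex_nonneg_Reals_iff)
  then show ?thesis
    by (simp add: cmod_eq_Re)
qed

context group
begin

context
  fixes M
  assumes M: "invariant_mean G M"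
begin

text \<open>The axioms for \<open>M\<close> speak of extensional functions only. This lemma and the
  next ones transfer them to arbitrary functions satisfying \<open>bohr\<close>, so that
  restrictions need not be carried through calculations.\<close>

lemma invariant_mean_add:
  assumes "bohr G f" "bohr G f'"
  shows "M (\<lambda>h\<in>carrier G. f h + f' h) = M (restrict f (carrier G)) + M (restrict f' (carrier G))"
proof -
  have "M (\<lambda>h\<in>carrier G. restrict f (carrier G) h + restrict f' (carrier G) h)
      = M (restrict f (carrier G)) + M (restrict f' (carrier G))"
    using M assms[THEN restrict_almost_periodic] unfolding invariant_mean_def by blast
  moreover have "(\<lambda>h\<in>carrier G. restrict f (carrier G) h + restrict f' (carrier G) h)
      = (\<lambda>h\<in>carrier G. f h + f' h)"
    by (rule restrict_ext) simp
  ultimately show ?thesis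
    by (simp only:)
qed

lemma invariant_mean_scale:
  assumes "bohr G f"
  shows "M (\<lambda>h\<in>carrier G. c * f h) = c * M (restrict f (carrier G))"
proof -
  have "M (\<lambda>h\<in>carrier G. c * restrict f (carrier G) h) = c * M (restrict f (carrier G))"
    using M restrict_almost_periodic[OF assms] unfolding invariant_mean_def by blast
  moreover have "(\<lambda>h\<in>carrier G. c * restrict f (carrier G) h) = (\<lambda>h\<in>carrier G. c * f h)"
    by (rule restrict_ext) simp
  ultimately show ?thesis
    by (simp only:)
qed

lemma invariant_mean_const: "M (\<lambda>h\<in>carrier G. c) = c"
proof -
  have "M (\<lambda>h\<in>carrier G. 1) = 1"
    using M unfolding invariant_mean_def by blast
  then show ?thesis
    using invariant_mean_scale[OF bohr_const[of 1], of c] by (simp only: mult_1_right)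
qed

lemma invariant_mean_translate:
  assumes "bohr G f" "g \<in> carrier G"
  shows "M (\<lambda>h\<in>carrier G. f (h \<otimes> g)) = M (restrict f (carrier G))"
proof -
  have "M (translate G g (restrict f (carrier G))) = M (restrict f (carrier G))"
    using M restrict_almost_periodic[OF assms(1)] assms(2) unfolding invariant_mean_def by blast
  moreover have "translate G g (restrict f (carrier G)) = (\<lambda>h\<in>carrier G. f (h \<otimes> g))"
    unfolding translate_def by (rule restrict_ext) (use assms(2) in simp)
  ultimately show ?thesis
    by (simp only:)
qed

lemma invariant_mean_nonneg:
  assumes "bohr G f" "\<And>h. h \<in> carrier G \<Longrightarrow> f h \<in> \<real>\<^sub>\<ge>\<^sub>0"
  shows "M (restrict f (carrier G)) \<in> \<real>\<^sub>\<ge>\<^sub>0"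
proof -
  have "\<forall>h\<in>carrier G. restrict f (carrier G) h \<in> \<real>\<^sub>\<ge>\<^sub>0"
    using assms(2) by simp
  then show ?thesis
    using M restrict_almost_periodic[OF assms(1)] unfolding invariant_mean_def by blast
qed

lemma invariant_mean_sum_translates:
  assumes f: "bohr G f" and "finite N" "N \<subseteq> carrier G"
  shows "bohr G (\<lambda>h. \<Sum>n\<in>N. f (h \<otimes> n)) \<and>
    M (\<lambda>h\<in>carrier G. \<Sum>n\<in>N. f (h \<otimes> n)) = of_nat (card N) * M (restrict f (carrier G))"
  using assms(2,3)
proof (induction N rule: finite_induct)
  case empty
  show ?case
    by (simp only: sum.empty card.empty of_nat_0 mult_zero_left invariant_mean_const bohr_const simp_thms)
next
  case (insert n N)
  then have n: "n \<in> carrier G" and IH: "bohr G (\<lambda>h. \<Sum>n\<in>N. f (h \<otimes> n))"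
    "M (\<lambda>h\<in>carrier G. \<Sum>n\<in>N. f (h \<otimes> n)) = of_nat (card N) * M (restrict f (carrier G))"
    by blast+
  have eq: "(\<Sum>m\<in>insert n N. f (h \<otimes> m)) = f (h \<otimes> n) + (\<Sum>m\<in>N. f (h \<otimes> m))" for h
    using insert.hyps by simp
  have "bohr G (\<lambda>h. f (h \<otimes> n) + (\<Sum>m\<in>N. f (h \<otimes> m)))"
    using bohr_linear[OF bohr_mean_translate(1)[OF f n] IH(1), of 1] by simp
  moreover have "M (\<lambda>h\<in>carrier G. f (h \<otimes> n) + (\<Sum>m\<in>N. f (h \<otimes> m)))
      = M (restrict f (carrier G)) + of_nat (card N) * M (restrict f (carrier G))"
    by (simp only: invariant_mean_add[OF bohr_mean_translate(1)[OF f n] IH(1)] IH(2)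
        invariant_mean_translate[OF f n])
  moreover have "of_nat (card (insert n N)) = 1 + (of_nat (card N) :: complex)"
    using insert.hyps by simp
  ultimately show ?case
    by (simp only: eq distrib_right mult_1 simp_thms)
qed

text \<open>Each step of \<open>T\<close> is a normalized finite sum of right translates, which
  linearity and right invariance reduce to \<open>card N\<close> equal terms.\<close>

lemma invariant_mean_right_average:
  assumes f: "bohr G f" and "T \<in> right_averages G"
  shows "M (restrict (T f) (carrier G)) = M (restrict f (carrier G))"
  using assms(2)
proof (induction rule: averages.induct)
  case (step T N)
  have T: "bohr G (T f)"
    by (rule bohr_right_average[OF f step(1)])
  have "trans_avg (\<lambda>k h. h \<otimes> k) N (T f) = (\<lambda>h. inverse (of_nat (card N)) * (\<Sum>n\<in>N. T f (h \<otimes> n)))"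
    by (simp add: trans_avg_def fun_eq_iff divide_inverse mult.commute)
  moreover have card: "of_nat (card N) \<noteq> (0 :: complex)"
    using step(2,3) by simp
  ultimately have "M (restrict (trans_avg (\<lambda>k h. h \<otimes> k) N (T f)) (carrier G))
      = inverse (of_nat (card N)) * (of_nat (card N) * M (restrict (T f) (carrier G)))"
    using invariant_mean_sum_translates[OF T step(2,4)]
    by (simp only: invariant_mean_scale)
  also have "\<dots> = M (restrict f (carrier G))"
    by (simp only: step.IH mult.assoc[symmetric] left_inverse[OF card] mult_1)
  finally show ?case .
qed simp

text \<open>Continuity of \<open>M\<close> is not an axiom but follows from positivity: both
  \<open>\<epsilon> + f\<close> and \<open>\<epsilon> - f\<close> are nonnegative, the sign being
  \<open>s\<close>. Since nonnegative complex numbers are real, this also forces \<open>M\<close> to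
  be real there.\<close>

lemma invariant_mean_real_near_0:
  assumes f: "bohr G f" and "\<And>h. h \<in> carrier G \<Longrightarrow> f h \<in> \<real> \<and> norm (f h) \<le> \<epsilon>"
  shows "norm (M (restrict f (carrier G))) \<le> \<epsilon>"
proof (rule cmod_le_of_real_bounds)
  have nonneg: "complex_of_real \<epsilon> + s * f h \<in> \<real>\<^sub>\<ge>\<^sub>0" if "h \<in> carrier G" "s = 1 \<or> s = -1" for h s
    using assms(2)[OF that(1)] that(2)
    by (auto simp: complex_nonneg_Reals_iff complex_is_Real_iff cmod_eq_Re abs_le_iff)
  have eq: "M (\<lambda>h\<in>carrier G. s * f h + complex_of_real \<epsilon>)
      = s * M (restrict f (carrier G)) + complex_of_real \<epsilon>" for s
    using invariant_mean_add[OF bohr_linear[OF f bohr_const[of 0], of s] bohr_const]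
      invariant_mean_scale[OF f, of s] by (simp add: invariant_mean_const)
  have "s * M (restrict f (carrier G)) + complex_of_real \<epsilon> \<in> \<real>\<^sub>\<ge>\<^sub>0" if "s = 1 \<or> s = -1" for s
    unfolding eq[symmetric]
    by (rule invariant_mean_nonneg[OF bohr_linear[OF f bohr_const]]) (use nonneg[OF _ that] in \<open>simp add: add.commute\<close>)
  from this[of 1] this[of "-1"]
  show "complex_of_real \<epsilon> + M (restrict f (carrier G)) \<in> \<real>\<^sub>\<ge>\<^sub>0"
    "complex_of_real \<epsilon> - M (restrict f (carrier G)) \<in> \<real>\<^sub>\<ge>\<^sub>0"
    by (simp_all add: add.commute)
qed

text \<open>Positivity speaks only about real-valued functions, so \<open>f - c\<close> is split
  into real and imaginary part. Hence the bound \<open>2 * \<epsilon>\<close>, which is good enough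
  as \<open>\<epsilon>\<close> will be arbitrary.\<close>

lemma invariant_mean_near_const:
  assumes f: "bohr G f" and "\<And>h. h \<in> carrier G \<Longrightarrow> norm (f h - c) \<le> \<epsilon>"
  shows "norm (M (restrict f (carrier G)) - c) \<le> 2 * \<epsilon>"
proof -
  define f' where "f' h = f h - c" for h
  have f': "bohr G f'"
    using bohr_linear[OF f bohr_const[of "-c"], of 1] by (simp add: f'_def[abs_def])
  define r where "r h = complex_of_real (Re (f' h))" for h
  define i where "i h = complex_of_real (Im (f' h))" for h
  have r: "bohr G r" and i: "bohr G i"
    using bohr_Re[OF f'] bohr_Im[OF f'] by (simp_all add: r_def[abs_def] i_def[abs_def])
  have "norm (r h) \<le> \<epsilon>" "norm (i h) \<le> \<epsilon>" if "h \<in> carrier G" for h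
    using assms(2)[OF that] abs_Re_le_cmod[of "f' h"] abs_Im_le_cmod[of "f' h"]
    unfolding r_def i_def f'_def norm_of_real by linarith+
  then have near: "norm (M (restrict r (carrier G))) \<le> \<epsilon>" "norm (M (restrict i (carrier G))) \<le> \<epsilon>"
    using invariant_mean_real_near_0[OF r] invariant_mean_real_near_0[OF i]
    by (auto simp: r_def i_def)
  have ii: "bohr G (\<lambda>h. \<i> * i h)"
    using bohr_linear[OF i bohr_const[of 0], of \<i>] by simp
  have "f = (\<lambda>h. (r h + \<i> * i h) + c)"
    by (auto simp: f'_def r_def i_def fun_eq_iff complex_eq_iff)
  then have "M (restrict f (carrier G)) = M (\<lambda>h\<in>carrier G. (r h + \<i> * i h) + c)"
    by simp
  also have "\<dots> = M (restrict r (carrier G)) + \<i> * M (restrict i (carrier G)) + c"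
    using bohr_linear[OF r ii, of 1]
    by (simp add: invariant_mean_add r ii bohr_const invariant_mean_scale i invariant_mean_const)
  finally have "M (restrict f (carrier G)) - c = M (restrict r (carrier G)) + \<i> * M (restrict i (carrier G))"
    by simp
  then show ?thesis
    using near norm_triangle_ineq[of "M (restrict r (carrier G))" "\<i> * M (restrict i (carrier G))"]
    by (simp add: norm_mult)
qed

text \<open>\<open>M\<close> cannot distinguish \<open>f\<close> from a right average of it, and
  some right averages are nearly the constant \<open>bohr_mean G f\<close>.\<close>

lemma invariant_mean_eq_bohr_mean:
  assumes f: "bohr G f"
  shows "M (restrict f (carrier G)) = bohr_mean G f"
proof -
  have "norm (M (restrict f (carrier G)) - bohr_mean G f) \<le> 0 + \<epsilon>" if "\<epsilon> > 0" for \<epsilon>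
  proof -
    have "\<epsilon> / 2 > 0"
      using that by simp
    then obtain T where T: "T \<in> right_averages G"
      "\<And>x. x \<in> carrier G \<Longrightarrow> norm (T f x - bohr_mean G f) \<le> \<epsilon> / 2"
      using average_value_bohr_mean(2)[OF f] unfolding average_value_def by blast
    show ?thesis
      using invariant_mean_near_const[OF bohr_right_average[OF f T(1)] T(2)]
      by (simp add: invariant_mean_right_average[OF f T(1)])
  qed
  then have "norm (M (restrict f (carrier G)) - bohr_mean G f) \<le> 0"
    by (rule field_le_epsilon)
  then show ?thesis
    by simp
qed

end

section \<open>Existence of the invariant mean and its identification\<close>

lemma almost_periodicD:
  assumes "f \<in> almost_periodic G"
  shows "bohr G f" "restrict f (carrier G) = f"
  using assms by (auto simp: almost_periodic_iff_bohr extensional_restrict)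

lemma invariant_mean_bohr_mean: "invariant_mean G (restrict (bohr_mean G) (almost_periodic G))"
proof -
  have m: "restrict (bohr_mean G) (almost_periodic G) (restrict f (carrier G)) = bohr_mean G f"
    if "bohr G f" for f
    using restrict_almost_periodic[OF that] bohr_mean_cong[OF that, of "restrict f (carrier G)"] by simp
  show ?thesis
    unfolding invariant_mean_def
  proof (intro conjI ballI allI impI)
    fix f f' assume f: "f \<in> almost_periodic G" "f' \<in> almost_periodic G"
    note b = almost_periodicD(1)[OF f(1)] almost_periodicD(1)[OF f(2)]
    show "restrict (bohr_mean G) (almost_periodic G) (\<lambda>h\<in>carrier G. f h + f' h)
        = restrict (bohr_mean G) (almost_periodic G) f + restrict (bohr_mean G) (almost_periodic G) f'"
      using m[OF bohr_linear[OF b, of 1]] bohr_mean_linear[OF b, of 1] f by simp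
  next
    fix c f assume f: "f \<in> almost_periodic G"
    note b = almost_periodicD(1)[OF f]
    \<comment> \<open>Homogeneity is obtained from linearity with second function 0, whose mean must
      therefore be known.\<close>
    have "bohr_mean G (\<lambda>g. 0) = 0"
      using bohr_mean_closed_convex[OF bohr_const, of "{0}" 0] by simp
    then show "restrict (bohr_mean G) (almost_periodic G) (\<lambda>h\<in>carrier G. c * f h)
        = c * restrict (bohr_mean G) (almost_periodic G) f"
      using m[OF bohr_linear[OF b bohr_const[of 0], of c]]
        bohr_mean_linear[OF b bohr_const[of 0], of c] f by simp
  next
    fix f assume f: "f \<in> almost_periodic G" and "\<forall>h\<in>carrier G. f h \<in> \<real>\<^sub>\<ge>\<^sub>0"
    moreover have "convex (\<real>\<^sub>\<ge>\<^sub>0 :: complex set)"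
      by (auto simp: convex_def complex_nonneg_Reals_iff)
    ultimately have "bohr_mean G f \<in> \<real>\<^sub>\<ge>\<^sub>0"
      using almost_periodicD(1)[OF f] by (intro bohr_mean_closed_convex) auto
    then show "restrict (bohr_mean G) (almost_periodic G) f \<in> \<real>\<^sub>\<ge>\<^sub>0"
      using f by simp
  next
    have "bohr_mean G (\<lambda>g. 1) \<in> {1}"
      by (rule bohr_mean_closed_convex[OF bohr_const]) auto
    then show "restrict (bohr_mean G) (almost_periodic G) (\<lambda>h\<in>carrier G. 1) = 1"
      using m[OF bohr_const] by simp
  next
    fix f g assume f: "f \<in> almost_periodic G" and g: "g \<in> carrier G"
    show "restrict (bohr_mean G) (almost_periodic G) (translate G g f)
        = restrict (bohr_mean G) (almost_periodic G) f"
      unfolding translate_def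
      using m[OF bohr_mean_translate(1)[OF almost_periodicD(1)[OF f] g]]
        bohr_mean_translate(2)[OF almost_periodicD(1)[OF f] g] f by simp
  qed auto
qed

lemma ap_mean_eq_bohr_mean:
  assumes "f \<in> almost_periodic G"
  shows "ap_mean G f = bohr_mean G f"
proof -
  have "ap_mean G = restrict (bohr_mean G) (almost_periodic G)"
    unfolding ap_mean_def
  proof (rule the_equality[where P = "invariant_mean G", OF invariant_mean_bohr_mean])
    fix M assume M: "invariant_mean G M"
    show "M = restrict (bohr_mean G) (almost_periodic G)"
    proof (rule extensionalityI)
      show "M \<in> extensional (almost_periodic G)"
        using M by (simp add: invariant_mean_def)
      fix f assume "f \<in> almost_periodic G"
      then show "M f = restrict (bohr_mean G) (almost_periodic G) f"
        using invariant_mean_eq_bohr_mean[OF M almost_periodicD(1)] almost_periodicD(2) by simp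
    qed simp
  qed
  then show ?thesis
    using assms by simp
qed

end

section \<open>Lyapunov stable actions\<close>

text \<open>Pulling the \<open>\<epsilon>\<close>-neighbourhood of the diagonal back along
  \<open>\<phi>\<close> gives an entourage, to which stability applies. The outcome is
  equicontinuity at \<open>x\<close> of all functions
  \<open>\<phi> \<circ> \<alpha> g\<close>.\<close>

lemma lyapunov_stable_uniform:
  fixes \<phi> :: "'a \<Rightarrow> complex"
  assumes "lyapunov_stable \<Gamma> X \<alpha>" "continuous_map X euclidean \<phi>" "x \<in> topspace X" "\<epsilon> > 0"
  shows "\<exists>W. openin X W \<and> x \<in> W \<and> (\<forall>y\<in>W. \<forall>g\<in>carrier \<Gamma>. norm (\<phi> (\<alpha> g x) - \<phi> (\<alpha> g y)) < \<epsilon>)"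
proof -
  define U where "U = {p \<in> topspace (prod_topology X X). norm (\<phi> (fst p) - \<phi> (snd p)) \<in> {..<\<epsilon>}}"
  have "continuous_map (prod_topology X X) euclidean (\<lambda>p. norm (\<phi> (fst p) - \<phi> (snd p)))"
    using continuous_map_compose[OF continuous_map_fst assms(2)]
      continuous_map_compose[OF continuous_map_snd assms(2)]
    by (intro continuous_map_norm continuous_map_diff) (simp_all add: o_def)
  then have "openin (prod_topology X X) U"
    unfolding U_def by (rule openin_continuous_map_preimage) simp
  then have "U \<in> diagonal_nbhds X"
    using assms(4) by (auto simp: diagonal_nbhds_def U_def intro!: exI[of _ U])
  then obtain V where V: "V \<in> diagonal_nbhds X"
    "\<And>y g. (x, y) \<in> V \<Longrightarrow> g \<in> carrier \<Gamma> \<Longrightarrow> (\<alpha> g x, \<alpha> g y) \<in> U"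
    using assms(1,3) unfolding lyapunov_stable_def by meson
  obtain W where W: "openin (prod_topology X X) W" "Id_on (topspace X) \<subseteq> W" "W \<subseteq> V"
    using V(1) by (auto simp: diagonal_nbhds_def)
  \<comment> \<open>The slice at \<open>x\<close> of an open neighbourhood of the diagonal is an
    open neighbourhood of \<open>x\<close>.\<close>
  have "openin X {y \<in> topspace X. (x, y) \<in> W}"
    using assms(3) by (intro openin_continuous_map_preimage[OF _ W(1)] continuous_map_pairedI) auto
  moreover have "norm (\<phi> (\<alpha> g x) - \<phi> (\<alpha> g y)) < \<epsilon>" if "(x, y) \<in> W" "g \<in> carrier \<Gamma>" for y g
    using V(2)[of y g] that W(3) by (auto simp: U_def)
  ultimately show ?thesis
    using assms(3) W(2) by (intro exI[of _ "{y \<in> topspace X. (x, y) \<in> W}"]) auto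
qed

text \<open>Since \<open>\<phi>_x(hg) = \<phi>(h(gx))\<close>, group elements that move
  \<open>x\<close> into the same small set have close translates. Compactness covers
  \<open>X\<close> by finitely many such sets.\<close>

lemma orbit_fun_almost_periodic:
  fixes \<Gamma> :: "('g, 'c) monoid_scheme" and \<phi> :: "'a \<Rightarrow> complex"
  assumes "group \<Gamma>" "compact_space X" "group_action \<Gamma> (topspace X) \<alpha>" "lyapunov_stable \<Gamma> X \<alpha>"
    and \<phi>: "continuous_map X euclidean \<phi>" and x: "x \<in> topspace X"
  shows "orbit_fun \<Gamma> \<alpha> \<phi> x \<in> almost_periodic \<Gamma>"
proof -
  interpret group \<Gamma> by fact
  interpret group_action \<Gamma> "topspace X" \<alpha> by fact
  have in_X: "\<alpha> g y \<in> topspace X" if "g \<in> carrier \<Gamma>" "y \<in> topspace X" for g y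
    using element_image[OF that refl] .
  show ?thesis
  proof (rule almost_periodicI)
    have "compact (\<phi> ` topspace X)"
      using image_compactin[OF _ \<phi>] assms(2) by (auto simp: compact_space_def)
    moreover have "orbit_fun \<Gamma> \<alpha> \<phi> x ` carrier \<Gamma> \<subseteq> \<phi> ` topspace X"
      using in_X x by (auto simp: orbit_fun_def)
    ultimately show "bounded (orbit_fun \<Gamma> \<alpha> \<phi> x ` carrier \<Gamma>)"
      using compact_imp_bounded bounded_subset by blast
  next
    fix \<epsilon> :: real
    assume "\<epsilon> > 0"
    have "\<forall>z\<in>topspace X. \<exists>W. openin X W \<and> z \<in> W \<and>
        (\<forall>y\<in>W. \<forall>g\<in>carrier \<Gamma>. norm (\<phi> (\<alpha> g z) - \<phi> (\<alpha> g y)) < \<epsilon> / 2)"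
      using lyapunov_stable_uniform[OF assms(4) \<phi> _ half_gt_zero[OF \<open>\<epsilon> > 0\<close>]] by blast
    then obtain W where W: "\<And>z. z \<in> topspace X \<Longrightarrow> openin X (W z)" "\<And>z. z \<in> topspace X \<Longrightarrow> z \<in> W z"
      "\<And>z y g. z \<in> topspace X \<Longrightarrow> y \<in> W z \<Longrightarrow> g \<in> carrier \<Gamma> \<Longrightarrow> norm (\<phi> (\<alpha> g z) - \<phi> (\<alpha> g y)) < \<epsilon> / 2"
      unfolding bchoice_iff by blast
    have "\<exists>\<F>. finite \<F> \<and> \<F> \<subseteq> W ` topspace X \<and> topspace X \<subseteq> \<Union>\<F>"
      using assms(2) unfolding compact_space_def
      by (rule compactinD) (use W(1,2) in auto)
    then obtain \<F> where \<F>: "finite \<F>" "\<F> \<subseteq> W ` topspace X" "topspace X \<subseteq> \<Union>\<F>"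
      by auto
    obtain F where "F \<subseteq> topspace X" "finite F" "\<F> = W ` F"
      using finite_subset_image[OF \<F>(1,2)] by auto
    then have F: "finite F" "F \<subseteq> topspace X" "topspace X \<subseteq> \<Union>(W ` F)"
      using \<F>(3) by auto
    \<comment> \<open>The colour of \<open>g\<close> is the centre of a covering set containing
      \<open>\<alpha> g x\<close>. Centres need not lie on the orbit of \<open>x\<close>, so the net
      is formed by group elements representing the colours.\<close>
    have "\<forall>g\<in>carrier \<Gamma>. \<exists>z. z \<in> F \<and> \<alpha> g x \<in> W z"
      using F(3) in_X x by blast
    then obtain c where c: "\<And>g. g \<in> carrier \<Gamma> \<Longrightarrow> c g \<in> F \<and> \<alpha> g x \<in> W (c g)"
      unfolding bchoice_iff by blast
    have fin: "finite (c ` carrier \<Gamma>)"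
      by (rule finite_subset[OF _ F(1)]) (use c in auto)
    obtain N where N: "N \<subseteq> carrier \<Gamma>" "finite N" "\<And>g. g \<in> carrier \<Gamma> \<Longrightarrow> \<exists>n\<in>N. c g = c n"
      using finite_representatives[OF fin] by auto
    have near: "norm (orbit_fun \<Gamma> \<alpha> \<phi> x (h \<otimes>\<^bsub>\<Gamma>\<^esub> g) - \<phi> (\<alpha> h (c g))) \<le> \<epsilon> / 2"
      if "g \<in> carrier \<Gamma>" "h \<in> carrier \<Gamma>" for g h
      using W(3)[of "c g" "\<alpha> g x" h] c[OF that(1)] F(2) that x
      by (auto simp: orbit_fun_def composition_rule norm_minus_commute less_imp_le)
    have "\<exists>n\<in>N. \<forall>h\<in>carrier \<Gamma>.
        norm (orbit_fun \<Gamma> \<alpha> \<phi> x (h \<otimes>\<^bsub>\<Gamma>\<^esub> g) - orbit_fun \<Gamma> \<alpha> \<phi> x (h \<otimes>\<^bsub>\<Gamma>\<^esub> n)) \<le> \<epsilon>"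
      if g: "g \<in> carrier \<Gamma>" for g
    proof -
      obtain n where n: "n \<in> N" "c g = c n"
        using N(3)[OF g] by auto
      then have "norm (orbit_fun \<Gamma> \<alpha> \<phi> x (h \<otimes>\<^bsub>\<Gamma>\<^esub> g) - orbit_fun \<Gamma> \<alpha> \<phi> x (h \<otimes>\<^bsub>\<Gamma>\<^esub> n)) \<le> 2 * (\<epsilon> / 2)"
        if "h \<in> carrier \<Gamma>" for h
        using norm_diff_le_via[OF near[OF g that], of "orbit_fun \<Gamma> \<alpha> \<phi> x (h \<otimes>\<^bsub>\<Gamma>\<^esub> n)"]
          near[of n h] N(1) that by auto
      then show ?thesis
        using n(1) by auto
    qed
    then show "\<exists>N\<subseteq>carrier \<Gamma>. finite N \<and> (\<forall>g\<in>carrier \<Gamma>. \<exists>n\<in>N. \<forall>h\<in>carrier \<Gamma>.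
        norm (orbit_fun \<Gamma> \<alpha> \<phi> x (h \<otimes>\<^bsub>\<Gamma>\<^esub> g) - orbit_fun \<Gamma> \<alpha> \<phi> x (h \<otimes>\<^bsub>\<Gamma>\<^esub> n)) \<le> \<epsilon>)"
      using N(1,2) by auto
  qed (simp add: orbit_fun_def)
qed

text \<open>If \<open>\<phi>\<close> vanishes on the whole orbit of \<open>x\<close>, then
  \<open>\<phi>_x\<close> is zero although \<open>\<phi>\<close> may be non-zero elsewhere: take the
  trivial action on two points. The non-vanishing clause is therefore stated for
  \<open>\<phi>\<close> that is non-zero somewhere on the closure of the orbit. Membership in
  \<open>almost_periodic\<close> is what gives meaning to the value of \<open>ap_mean\<close> in the
  expectation.\<close>

theorem theorem2p8:
  fixes \<Gamma> :: "('g, 'c) monoid_scheme" and X :: "'a topology" and \<alpha> :: "'g \<Rightarrow> 'a \<Rightarrow> 'a"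
  assumes "group \<Gamma>"
    and "compact_space X" and "Hausdorff_space X"
    and "continuous_action \<Gamma> X \<alpha>"
    and "lyapunov_stable \<Gamma> X \<alpha>"
  shows "expectation \<Gamma> \<alpha> \<in> cont_funs X \<rightarrow> inv_cont_funs \<Gamma> X \<alpha> \<and>
    (\<forall>\<phi>\<in>cont_funs X. continuous_map X euclidean (\<lambda>x. expectation \<Gamma> \<alpha> \<phi> x)) \<and>
    (\<forall>x\<in>topspace X. \<forall>\<phi>\<in>cont_funs X.
       orbit_fun \<Gamma> \<alpha> \<phi> x \<in> almost_periodic \<Gamma> \<and>
       ((\<exists>y\<in>X closure_of (orbit \<Gamma> \<alpha> x). \<phi> y \<noteq> 0) \<longrightarrow>
          (\<exists>g\<in>carrier \<Gamma>. orbit_fun \<Gamma> \<alpha> \<phi> x g \<noteq> 0)))"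
proof -
  interpret group \<Gamma> by fact
  have act: "group_action \<Gamma> (topspace X) \<alpha>"
    using assms(4) by (simp add: continuous_action_def)
  interpret group_action \<Gamma> "topspace X" \<alpha> by fact
  have ap: "orbit_fun \<Gamma> \<alpha> \<phi> x \<in> almost_periodic \<Gamma>" if "\<phi> \<in> cont_funs X" "x \<in> topspace X" for \<phi> x
    using orbit_fun_almost_periodic[OF assms(1,2) act assms(5)] that by (simp add: cont_funs_def)
  note bohr = almost_periodicD(1)[OF ap]
  have E: "expectation \<Gamma> \<alpha> \<phi> x = bohr_mean \<Gamma> (orbit_fun \<Gamma> \<alpha> \<phi> x)"
    if "\<phi> \<in> cont_funs X" "x \<in> topspace X" for \<phi> x
    unfolding expectation_def by (rule ap_mean_eq_bohr_mean[OF ap[OF that]])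
  have cont: "continuous_map X euclidean (expectation \<Gamma> \<alpha> \<phi>)" if \<phi>: "\<phi> \<in> cont_funs X" for \<phi>
    unfolding mtopology_is_euclidean[symmetric] Met_TC.continuous_map_to_metric
  proof (intro ballI allI impI)
    fix x and \<epsilon> :: real
    assume x: "x \<in> topspace X" and "\<epsilon> > 0"
    then obtain W where W: "openin X W" "x \<in> W"
      "\<And>y g. y \<in> W \<Longrightarrow> g \<in> carrier \<Gamma> \<Longrightarrow> norm (\<phi> (\<alpha> g x) - \<phi> (\<alpha> g y)) < \<epsilon> / 2"
      using lyapunov_stable_uniform[OF assms(5), of \<phi> x "\<epsilon> / 2"] \<phi> by (auto simp: cont_funs_def)
    have "dist (expectation \<Gamma> \<alpha> \<phi> x) (expectation \<Gamma> \<alpha> \<phi> y) < \<epsilon>" if "y \<in> W" for y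
    proof -
      have y: "y \<in> topspace X"
        using openin_subset[OF W(1)] that by auto
      \<comment> \<open>The difference of two means is the mean of the difference, which takes
        values in a closed ball. The radius \<open>\<epsilon> / 2\<close> leaves room for the strict
        inequality.\<close>
      have "bohr_mean \<Gamma> (\<lambda>g. - 1 * orbit_fun \<Gamma> \<alpha> \<phi> y g + orbit_fun \<Gamma> \<alpha> \<phi> x g) \<in> cball 0 (\<epsilon> / 2)"
      proof (rule bohr_mean_closed_convex[OF bohr_linear[OF bohr[OF \<phi> y] bohr[OF \<phi> x]]])
        show "- 1 * orbit_fun \<Gamma> \<alpha> \<phi> y g + orbit_fun \<Gamma> \<alpha> \<phi> x g \<in> cball 0 (\<epsilon> / 2)"
          if "g \<in> carrier \<Gamma>" for g
          using W(3)[OF \<open>y \<in> W\<close> that] that by (simp add: orbit_fun_def)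
      qed auto
      then show ?thesis
        unfolding bohr_mean_linear[OF bohr[OF \<phi> y] bohr[OF \<phi> x]]
        using \<open>\<epsilon> > 0\<close> by (simp add: E[OF \<phi> x] E[OF \<phi> y] dist_norm norm_minus_commute)
    qed
    then show "\<exists>W. openin X W \<and> x \<in> W \<and> (\<forall>y\<in>W. expectation \<Gamma> \<alpha> \<phi> y \<in> Met_TC.mball (expectation \<Gamma> \<alpha> \<phi> x) \<epsilon>)"
      using W(1,2) by (intro exI[of _ W]) simp
  qed
  have inv: "expectation \<Gamma> \<alpha> \<phi> (\<alpha> g x) = expectation \<Gamma> \<alpha> \<phi> x"
    if \<phi>: "\<phi> \<in> cont_funs X" and g: "g \<in> carrier \<Gamma>" and x: "x \<in> topspace X" for \<phi> g x
  proof -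
    have gx: "\<alpha> g x \<in> topspace X"
      using element_image[OF g x refl] .
    \<comment> \<open>The orbit function at \<open>\<alpha> g x\<close> is the right translate by
      \<open>g\<close> of the one at \<open>x\<close>, so invariance of the mean becomes invariance
      of the expectation.\<close>
    have "bohr_mean \<Gamma> (orbit_fun \<Gamma> \<alpha> \<phi> (\<alpha> g x)) = bohr_mean \<Gamma> (\<lambda>h. orbit_fun \<Gamma> \<alpha> \<phi> x (h \<otimes>\<^bsub>\<Gamma>\<^esub> g))"
      by (rule bohr_mean_cong[OF bohr_mean_translate(1)[OF bohr[OF \<phi> x] g]])
        (use g x in \<open>simp add: orbit_fun_def composition_rule\<close>)
    then show ?thesis
      using bohr_mean_translate(2)[OF bohr[OF \<phi> x] g] E[OF \<phi>] x gx by simp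
  qed
  have nonzero: "\<exists>g\<in>carrier \<Gamma>. orbit_fun \<Gamma> \<alpha> \<phi> x g \<noteq> 0"
    if \<phi>: "\<phi> \<in> cont_funs X" and y: "y \<in> X closure_of (orbit \<Gamma> \<alpha> x)" "\<phi> y \<noteq> 0" for \<phi> x y
  proof -
    \<comment> \<open>The set where \<open>\<phi>\<close> does not vanish is an open neighbourhood
      of \<open>y\<close>, hence meets the orbit.\<close>
    have "openin X {z \<in> topspace X. \<phi> z \<in> - {0}}"
      using \<phi> by (intro openin_continuous_map_preimage[of X euclidean]) (auto simp: cont_funs_def)
    moreover have "y \<in> {z \<in> topspace X. \<phi> z \<in> - {0}}"
      using y by (auto simp: in_closure_of)
    ultimately obtain z where "z \<in> orbit \<Gamma> \<alpha> x" "\<phi> z \<noteq> 0"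
      using conjunct2[OF iffD1[OF in_closure_of y(1)], THEN spec,
          of "{z \<in> topspace X. \<phi> z \<in> - {0}}"] by auto
    then show ?thesis
      by (auto simp: orbit_def orbit_fun_def)
  qed
  have "expectation \<Gamma> \<alpha> \<phi> \<in> inv_cont_funs \<Gamma> X \<alpha>" if "\<phi> \<in> cont_funs X" for \<phi>
    using cont[OF that] inv[OF that] by (simp add: inv_cont_funs_def cont_funs_def)
  then show ?thesis
    using cont ap nonzero by blast
qed

end
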